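(* Let $r\ge 1$ and let $K$ be an $r$-dimensional finite simplicial complex. Then the spectrum of the $(r-1)$-dimensional up-Laplacian of $K$ is majorized by the conjugate $(r-1)$-degree sequence of $K$: \[ \boldsymbol{\lambda}_{r-1}(K)\preccurlyeq \mathbf d_{r-1}^{\top}(K). \] That is, $\sum_{i=1}^{\ell}\lambda_{r-1,i}(K)\le\sum_{j=1}^{\ell}\deg^\top_{r-1,j}(K)$ for every integer $\ell\ge 1$, and $\sum_{i\ge 1}\lambda_{r-1,i}(K)=\sum_{j\ge 1}\deg^\top_{r-1,j}(K)$.
   Context: A (finite abstract) simplicial complex $K$ on a finite vertex set $V$ is a collection of subsets of $V$ closed under inclusion. An element of cardinality $i+1$ is an $i$-face; the dimension of $K$ is the maximum dimension of its faces. $S_i(K)$ is the set of $i$-faces, $f_i(K)=|S_i(K)|$, with $S_{-1}(K)=\{\emptyset\}$, $f_{-1}(K)=1$. Fix a linear order on $V$ and orient every face by the increasing order of its vertices. The $i$-th boundary map $\partial_i:C_i(K;\mathbb R)\to C_{i-1}(K;\mathbb R)$ between real chain spaces (with bases the oriented faces) is $\partial_i[v_0,\dots,v_i]=\sum_{j=0}^i(-1)^j[v_0,\dots,\widehat{v_j},\dots,v_i]$, and $B_i(K)\in\mathbb R^{f_{i-1}(K)\times f_i(K)}$ is its matrix. The $i$-dimensional up-Laplacian is $L_i^{\mathrm{up}}(K)=B_{i+1}(K)B_{i+1}(K)^\top$. Its eigenvalues in nonincreasing order, with multiplicity, form the sequence $\boldsymbol\lambda_i(K)=(\lambda_{i,1}(K)\ge\lambda_{i,2}(K)\ge\cdots\ge\lambda_{i,f_i(K)}(K))$.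 For an $i$-face $\sigma$ of the $r$-dimensional complex $K$, its degree is $\deg_i(K;\sigma)=|\{F\in S_r(K):\sigma\subseteq F\}|$. The $i$-degree sequence $\mathbf d_i(K)=(\deg_{i,1}(K)\ge\cdots\ge\deg_{i,f_i(K)}(K))$ lists the degrees of all $i$-faces in nonincreasing order, and the conjugate $i$-degree sequence is $\mathbf d_i^\top(K)=(\deg^\top_{i,1}(K)\ge\deg^\top_{i,2}(K)\ge\cdots)$ with $\deg^\top_{i,j}(K)=|\{t:\deg_{i,t}(K)\ge j\}|$ for $j\ge1$. All sequences are padded with zeros. For nonincreasing finitely supported sequences, $\mathbf x\preccurlyeq\mathbf y$ ($\mathbf x$ is majorized by $\mathbf y$) means $\sum_{i=1}^\ell x_i\le\sum_{i=1}^\ell y_i$ for every $\ell\ge1$ and $\sum_{i\ge1}x_i=\sum_{i\ge1}y_i$. *)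

theory Defs
  imports Complex_Main "Jordan_Normal_Form.Char_Poly"
begin

text \<open>Simplicial complexes. Dimensions are integers, so that the empty face has dimension
  \<open>- 1\<close>; the empty face always belongs to the complex.\<close>

definition simplicial_complex :: "'a set \<Rightarrow> 'a set set \<Rightarrow> bool" where
  "simplicial_complex V K \<longleftrightarrow>
     finite V \<and> K \<subseteq> Pow V \<and> {} \<in> K \<and> (\<forall>F\<in>K. \<forall>G. G \<subseteq> F \<longrightarrow> G \<in> K)"

definition faces :: "'a set set \<Rightarrow> int \<Rightarrow> 'a set set" where
  "faces K i = {F \<in> K. int (card F) = i + 1}"

definition complex_dim :: "'a set set \<Rightarrow> int" where
  "complex_dim K = Max ((\<lambda>F. int (card F) - 1) ` K)"

text \<open>A chain is given by its coefficient function on faces; every face is oriented by the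
  increasing order of its vertices.\<close>

definition elementary_chain :: "'a set \<Rightarrow> 'a set \<Rightarrow> real" where
  "elementary_chain F = (\<lambda>G. if G = F then 1 else 0)"

definition boundary_face :: "'a::linorder set \<Rightarrow> 'a set \<Rightarrow> real" where
  "boundary_face F = (\<lambda>G. \<Sum>j<card F. (- 1) ^ j *
     elementary_chain (F - {sorted_list_of_set F ! j}) G)"

definition boundary_map ::
    "'a::linorder set set \<Rightarrow> int \<Rightarrow> ('a set \<Rightarrow> real) \<Rightarrow> 'a set \<Rightarrow> real" where
  "boundary_map K i c = (\<lambda>G. \<Sum>F\<in>faces K i. c F * boundary_face F G)"

text \<open>An arbitrary but fixed enumeration of the \<open>i\<close>-faces, used to index rows and columns.
  Another choice permutes the rows and columns of the matrices below and hence does not change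
  the spectrum.\<close>

definition face_list :: "'a set set \<Rightarrow> int \<Rightarrow> 'a set list" where
  "face_list K i = (SOME Fs. distinct Fs \<and> set Fs = faces K i)"

definition boundary_matrix :: "'a::linorder set set \<Rightarrow> int \<Rightarrow> real mat" where
  "boundary_matrix K i = mat (card (faces K (i - 1))) (card (faces K i))
     (\<lambda>(a, b). boundary_map K i (elementary_chain (face_list K i ! b)) (face_list K (i - 1) ! a))"

definition up_laplacian :: "'a::linorder set set \<Rightarrow> int \<Rightarrow> real mat" where
  "up_laplacian K i = boundary_matrix K (i + 1) * transpose_mat (boundary_matrix K (i + 1))"

text \<open>Sequences are indexed from 1; the value at index 0 is irrelevant.\<close>

definition zero_padded :: "'b::zero list \<Rightarrow> nat \<Rightarrow> 'b" where
  "zero_padded xs j = (if 1 \<le> j \<and> j \<le> length xs then xs ! (j - 1) else 0)"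

definition nonincreasing_list :: "'b::linorder multiset \<Rightarrow> 'b list" where
  "nonincreasing_list M = rev (sorted_list_of_multiset M)"

text \<open>The real roots of the characteristic polynomial, with multiplicity. For a symmetric matrix
  these are all the eigenvalues.\<close>

definition eigenvalue_list :: "real mat \<Rightarrow> real list" where
  "eigenvalue_list A = nonincreasing_list (proots (char_poly A))"

definition laplacian_spectrum :: "'a::linorder set set \<Rightarrow> int \<Rightarrow> nat \<Rightarrow> real" where
  "laplacian_spectrum K i = zero_padded (eigenvalue_list (up_laplacian K i))"

definition face_degree :: "'a set set \<Rightarrow> 'a set \<Rightarrow> nat" where
  "face_degree K S = card {F \<in> faces K (complex_dim K). S \<subseteq> F}"

definition degree_list :: "'a set set \<Rightarrow> int \<Rightarrow> nat list" where
  "degree_list K i = nonincreasing_list (image_mset (face_degree K) (mset_set (faces K i)))"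

definition degree_sequence :: "'a set set \<Rightarrow> int \<Rightarrow> nat \<Rightarrow> nat" where
  "degree_sequence K i = zero_padded (degree_list K i)"

definition conjugate_degree_sequence :: "'a set set \<Rightarrow> int \<Rightarrow> nat \<Rightarrow> nat" where
  "conjugate_degree_sequence K i j =
     card {t \<in> {1..card (faces K i)}. degree_sequence K i t \<ge> j}"

text \<open>Majorization is a relation between nonincreasing finitely supported sequences, and the
  definition demands that both sequences are such; the infinite sums are therefore finite.\<close>

definition nonincreasing_finsupp :: "(nat \<Rightarrow> real) \<Rightarrow> bool" where
  "nonincreasing_finsupp x \<longleftrightarrow>
     (\<forall>i j. 1 \<le> i \<and> i \<le> j \<longrightarrow> x j \<le> x i) \<and> finite {i. 1 \<le> i \<and> x i \<noteq> 0}"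

definition majorized_by :: "(nat \<Rightarrow> real) \<Rightarrow> (nat \<Rightarrow> real) \<Rightarrow> bool" (infix "\<preccurlyeq>" 50) where
  "x \<preccurlyeq> y \<longleftrightarrow> nonincreasing_finsupp x \<and> nonincreasing_finsupp y \<and>
     (\<forall>l\<ge>1. (\<Sum>i=1..l. x i) \<le> (\<Sum>i=1..l. y i)) \<and>
     (\<Sum>i. x (Suc i)) = (\<Sum>i. y (Suc i))"

end

theory Submission
  imports Defs "HOL-Analysis.Function_Topology"
begin

text \<open>The sum of the \<open>t\<close> largest eigenvalues is the maximal energy of an orthonormal frame of \<open>t\<close>
  chains, and the sum of the first \<open>t\<close> conjugate degrees is \<open>\<Sum>\<^sub>\<sigma> min (deg \<sigma>) t\<close>. The inequality between
  the two is proved by induction on \<open>r\<close>. In the induction step, \<open>(r + 1) L\<close> is the sum over the vertices \<open>v\<close>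
  of the Laplacians of the stars, and the nonzero spectrum of such a star is the spectrum of the link of \<open>v\<close>
  shifted by 1. Hence the step costs \<open>\<Sum>\<^sub>v min (deg v) t\<close>, which is at most \<open>\<Sum>\<^sub>\<sigma> min (deg \<sigma>) t\<close>.

  The case \<open>r = 1\<close> is the Grone-Merris conjecture (a theorem of Bai). Making the vertices of degree at least
  \<open>t\<close> a clique \<open>C\<close> and the others an independent set \<open>D\<close> reduces it to split graphs. For \<open>|C|\<close>
  orthonormal eigenvectors with eigenvalue matrix \<open>\<Lambda>\<close>, let \<open>g\<^sub>v\<close> be the vector of their values at \<open>v\<close>, and
  choose \<open>f : C \<rightarrow> D\<close> maximizing \<open>|det (g\<^sub>i - g\<^bsub>f i\<^esub>)\<^sub>i|\<close>. Expanding \<open>tr \<Lambda>\<close> times this determinant column by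
  column, maximality bounds every term and yields \<open>tr \<Lambda> \<le> |C|\<^sup>2 + e(C, D)\<close>. At most \<open>|C|\<close> eigenvalues exceed
  \<open>|C|\<close>; if there are fewer, the same estimate is applied to the complementary split graph.\<close>

section \<open>Orthonormal frames on finite sets\<close>

text \<open>All bounds are stated for arbitrary orthonormal frames. The stars share no eigenbasis,
  but one frame can be tested against each of them and the bounds added, in the spirit of Ky Fan's
  principle; eigenvectors of the complex itself enter only at the end. The frame lives on the
  ridges, whereas a star is compared with its link through chains of top faces, so the step passes
  between \<open>B B^T\<close> and \<open>B^T B\<close>. This exchange can shorten a frame, hence
  the bounds for all sizes \<open>k <= t\<close>.

  The induction closes without slack. A top face has one vertex more than a ridge, so summing over
  the vertices counts the left side once more often than the ridge terms; the surplus copy of the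
  right side is exactly the room for the shifts by 1. A cost of \<open>t\<close> per vertex would
  not fit: it has to be cut down to the number of top faces in the star.

  The induction cannot start at \<open>r = 0\<close>, where the inequality fails: the only ridge is
  the empty set, and for \<open>n\<close> points its eigenvalue \<open>n\<close> faces the conjugate
  sequence \<open>1, ..., 1\<close>. So the graph case must be proved on its own.\<close>

definition ip :: "'x set \<Rightarrow> ('x \<Rightarrow> real) \<Rightarrow> ('x \<Rightarrow> real) \<Rightarrow> real" where
  "ip X f g = (\<Sum>x\<in>X. f x * g x)"

definition orthonormal :: "'x set \<Rightarrow> nat \<Rightarrow> (nat \<Rightarrow> 'x \<Rightarrow> real) \<Rightarrow> bool" where
  "orthonormal X k u \<longleftrightarrow> (\<forall>a<k. \<forall>b<k. ip X (u a) (u b) = (if a = b then 1 else 0))"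

lemma ip_commute: "ip X f g = ip X g f"
  by (simp add: ip_def mult.commute)

lemma ip_diff_left: "ip X (\<lambda>x. f x - g x) h = ip X f h - ip X g h"
  by (simp add: ip_def left_diff_distrib sum_subtractf)

lemma ip_add_left: "ip X (\<lambda>x. f x + g x) h = ip X f h + ip X g h"
  by (simp add: ip_def distrib_right sum.distrib)

lemma ip_scale_left: "ip X (\<lambda>x. c * f x) h = c * ip X f h"
  by (simp add: ip_def sum_distrib_left mult.assoc)

lemma ip_sum_left: "ip X (\<lambda>x. \<Sum>a\<in>I. f a x) h = (\<Sum>a\<in>I. ip X (f a) h)"
  unfolding ip_def sum_distrib_right by (rule sum.swap)

lemma ip_diff_right: "ip X h (\<lambda>x. f x - g x) = ip X h f - ip X h g"
  using ip_diff_left by (metis ip_commute)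

lemma ip_add_right: "ip X h (\<lambda>x. f x + g x) = ip X h f + ip X h g"
  using ip_add_left by (metis ip_commute)

lemma ip_scale_right: "ip X h (\<lambda>x. c * f x) = c * ip X h f"
  using ip_scale_left by (metis ip_commute)

lemma ip_sum_right: "ip X h (\<lambda>x. \<Sum>a\<in>I. f a x) = (\<Sum>a\<in>I. ip X h (f a))"
  by (simp add: ip_commute[of X h] ip_sum_left)

lemmas ip_linear = ip_diff_left ip_add_left ip_scale_left ip_sum_left
  ip_diff_right ip_add_right ip_scale_right ip_sum_right

lemma ip_cong: "(\<And>x. x \<in> X \<Longrightarrow> f x = f' x) \<Longrightarrow> (\<And>x. x \<in> X \<Longrightarrow> g x = g' x) \<Longrightarrow> ip X f g = ip X f' g'"
  by (simp add: ip_def)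

lemma ip_self_nonneg: "0 \<le> ip X f f"
  by (simp add: ip_def sum_nonneg)

lemma ip_self_eq_0: "finite X \<Longrightarrow> ip X f f = 0 \<longleftrightarrow> (\<forall>x\<in>X. f x = 0)"
  by (simp add: ip_def sum_nonneg_eq_0_iff)

lemma ip_indicator: "finite X \<Longrightarrow> x \<in> X \<Longrightarrow> ip X f (\<lambda>y. if y = x then 1 else 0) = f x"
  by (simp add: ip_def if_distrib cong: if_cong)

lemma orthonormal_mono: "orthonormal X k u \<Longrightarrow> l \<le> k \<Longrightarrow> orthonormal X l u"
  by (auto simp: orthonormal_def)

lemma ip_residual:
  fixes f :: "'x \<Rightarrow> real"
  assumes "orthonormal X k u"
  defines "r \<equiv> \<lambda>x. f x - (\<Sum>a<k. ip X (u a) f * u a x)"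
  shows "\<And>b. b < k \<Longrightarrow> ip X (u b) r = 0"
    and "ip X r r = ip X f f - (\<Sum>a<k. (ip X (u a) f)\<^sup>2)"
proof -
  show A: "ip X (u b) r = 0" if "b < k" for b
  proof -
    have "(\<Sum>a<k. ip X (u a) f * ip X (u b) (u a)) = (\<Sum>a<k. if a = b then ip X (u a) f else 0)"
      by (rule sum.cong) (use assms(1) that in \<open>auto simp: orthonormal_def\<close>)
    also have "\<dots> = ip X (u b) f" using that by simp
    finally show ?thesis by (simp add: r_def ip_linear)
  qed
  have "ip X r r = ip X f r - (\<Sum>a<k. ip X (u a) f * ip X (u a) r)"
    by (subst (1) r_def) (simp add: ip_linear)
  also have "\<dots> = ip X f r" using A by simp
  also have "\<dots> = ip X r f" by (rule ip_commute)
  also have "\<dots> = ip X f f - (\<Sum>a<k. (ip X (u a) f)\<^sup>2)"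
    by (simp add: r_def ip_linear power2_eq_square)
  finally show "ip X r r = ip X f f - (\<Sum>a<k. (ip X (u a) f)\<^sup>2)" .
qed

lemma bessel: "orthonormal X k u \<Longrightarrow> (\<Sum>a<k. (ip X (u a) f)\<^sup>2) \<le> ip X f f"
  by (subst diff_ge_0_iff_ge[symmetric], subst ip_residual(2)[symmetric]) (simp_all add: ip_self_nonneg)

lemma orthonormal_diag_le:
  assumes "finite X" "orthonormal X k u" "x \<in> X"
  shows "(\<Sum>a<k. (u a x)\<^sup>2) \<le> 1"
  using bessel[OF assms(2), of "\<lambda>y. if y = x then 1 else 0"] assms by (simp add: ip_indicator)

lemma orthonormal_trace:
  assumes "orthonormal X k u"
  shows "(\<Sum>x\<in>X. \<Sum>a<k. (u a x)\<^sup>2) = real k"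
proof -
  have "(\<Sum>x\<in>X. \<Sum>a<k. (u a x)\<^sup>2) = (\<Sum>a<k. ip X (u a) (u a))"
    unfolding ip_def power2_eq_square by (rule sum.swap)
  also have "\<dots> = real k" using assms by (simp add: orthonormal_def)
  finally show ?thesis .
qed

lemma orthonormal_card_le:
  assumes "finite X" "orthonormal X k u"
  shows "k \<le> card X"
proof -
  have "real k \<le> (\<Sum>x\<in>X. 1)"
    unfolding orthonormal_trace[OF assms(2), symmetric]
    by (rule sum_mono) (rule orthonormal_diag_le[OF assms])
  thus ?thesis by simp
qed

text \<open>The diagonal entries of the projection onto the span are at most 1 and add up to
  \<open>card X\<close>, so each is 1; hence every point indicator has zero residual.\<close>

lemma orthonormal_complete:
  assumes "finite X" "orthonormal X (card X) u" "x \<in> X" "y \<in> X"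
  shows "(\<Sum>a<card X. u a x * u a y) = (if x = y then 1 else 0)"
proof -
  let ?d = "\<lambda>z. if z = x then 1 else (0::real)"
  have "(\<Sum>z\<in>X. 1 - (\<Sum>a<card X. (u a z)\<^sup>2)) = 0"
    using orthonormal_trace[OF assms(2)] by (simp add: sum_subtractf)
  hence "(\<Sum>a<card X. (u a x)\<^sup>2) = 1"
    using sum_nonneg_eq_0_iff[OF assms(1), of "\<lambda>z. 1 - (\<Sum>a<card X. (u a z)\<^sup>2)"]
      orthonormal_diag_le[OF assms(1,2)] assms(3) by auto
  hence "ip X (\<lambda>y. ?d y - (\<Sum>a<card X. ip X (u a) ?d * u a y))
              (\<lambda>y. ?d y - (\<Sum>a<card X. ip X (u a) ?d * u a y)) = 0"
    by (intro trans[OF ip_residual(2)[OF assms(2), of ?d]]) (simp add: ip_indicator assms(1,3))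
  hence "\<forall>y\<in>X. ?d y - (\<Sum>a<card X. ip X (u a) ?d * u a y) = 0"
    by (simp only: ip_self_eq_0[OF assms(1)])
  hence "?d y - (\<Sum>a<card X. ip X (u a) ?d * u a y) = 0" using assms(4) by (rule bspec)
  thus ?thesis by (auto simp: ip_indicator[OF assms(1,3)] split: if_splits)
qed

lemma orthonormal_expand:
  assumes "finite X" "orthonormal X (card X) u" "y \<in> X"
  shows "f y = (\<Sum>a<card X. ip X (u a) f * u a y)"
proof -
  have "(\<Sum>a<card X. ip X (u a) f * u a y) = (\<Sum>x\<in>X. f x * (\<Sum>a<card X. u a x * u a y))"
    unfolding ip_def sum_distrib_left sum_distrib_right
    by (subst sum.swap) (simp add: ac_simps)
  also have "\<dots> = (\<Sum>x\<in>X. if x = y then f x else 0)"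
    by (rule sum.cong) (use orthonormal_complete[OF assms(1,2) _ assms(3)] in auto)
  also have "\<dots> = f y" using assms by simp
  finally show ?thesis by simp
qed

lemma parseval:
  assumes "finite X" "orthonormal X (card X) u"
  shows "ip X f g = (\<Sum>a<card X. ip X (u a) f * ip X (u a) g)"
proof -
  have "ip X f g = ip X (\<lambda>y. \<Sum>a<card X. ip X (u a) f * u a y) g"
    by (rule ip_cong) (rule orthonormal_expand[OF assms], simp_all)
  thus ?thesis by (simp add: ip_linear)
qed

text \<open>Dependent vectors are skipped, so \<open>k\<close> may be smaller than
  \<open>t\<close>.\<close>

lemma gram_schmidt_frame:
  fixes z :: "nat \<Rightarrow> 'x \<Rightarrow> real"
  assumes "finite X"
  obtains k u where "k \<le> t" "orthonormal X k u"
    "\<And>a x. a < t \<Longrightarrow> x \<in> X \<Longrightarrow> z a x = (\<Sum>b<k. ip X (u b) (z a) * u b x)"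
proof -
  have "\<exists>k u. k \<le> t \<and> orthonormal X k u \<and>
    (\<forall>a<t. \<forall>x\<in>X. z a x = (\<Sum>b<k. ip X (u b) (z a) * u b x))"
  proof (induction t)
    case 0
    show ?case by (auto simp: orthonormal_def)
  next
    case (Suc t)
    then obtain k u where ku: "k \<le> t" "orthonormal X k u"
      "\<And>a x. a < t \<Longrightarrow> x \<in> X \<Longrightarrow> z a x = (\<Sum>b<k. ip X (u b) (z a) * u b x)" by blast
    define r where "r = (\<lambda>x. z t x - (\<Sum>b<k. ip X (u b) (z t) * u b x))"
    have ru: "ip X (u b) r = 0" if "b < k" for b
      unfolding r_def by (rule ip_residual(1)[OF ku(2) that])
    show ?case
    proof (cases "ip X r r = 0")
      case True
      hence "\<forall>x\<in>X. r x = 0" using assms by (simp add: ip_self_eq_0)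
      hence "\<forall>a<Suc t. \<forall>x\<in>X. z a x = (\<Sum>b<k. ip X (u b) (z a) * u b x)"
        using ku(3) by (auto simp: less_Suc_eq r_def)
      thus ?thesis using ku(1,2) by (intro exI[of _ k] exI[of _ u]) auto
    next
      case False
      define n where "n = sqrt (ip X r r)"
      have n: "n > 0" "n * n = ip X r r" using False ip_self_nonneg[of X r] by (auto simp: n_def)
      define e where "e = (\<lambda>x. (1 / n) * r x)"
      define v where "v = u(k := e)"
      have ee: "ip X e e = 1" unfolding e_def ip_linear n(2)[symmetric] using n(1) by simp
      have ue: "ip X (u b) e = 0" "ip X e (u b) = 0" if "b < k" for b
        using ru[OF that] unfolding e_def ip_linear by (simp_all add: ip_commute[of X r "u b"])
      have on: "orthonormal X (Suc k) v"
        using ku(2) ee ue by (auto simp: orthonormal_def v_def less_Suc_eq)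
      have vu: "v b = u b" if "b < k" for b using that by (simp add: v_def)
      have r_eq: "r x = n * e x" for x using n by (simp add: e_def)
      have zt: "z t x = (\<Sum>b<k. ip X (u b) (z t) * u b x) + n * e x" for x
        using r_eq[of x] by (simp add: r_def)
      have e0: "ip X e (z a) = 0" if a: "a < t" for a
      proof -
        have "ip X e (z a) = ip X e (\<lambda>x. \<Sum>b<k. ip X (u b) (z a) * u b x)"
          by (rule ip_cong) (use ku(3)[OF a] in auto)
        also have "\<dots> = 0" using ue by (simp add: ip_linear)
        finally show ?thesis .
      qed
      have "ip X e (z t) = ip X e (\<lambda>x. (\<Sum>b<k. ip X (u b) (z t) * u b x) + n * e x)"
        by (rule ip_cong) (use zt in auto)
      also have "\<dots> = n" using ue ee by (simp add: ip_linear)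
      finally have et: "ip X e (z t) = n" .
      have "\<forall>a<Suc t. \<forall>x\<in>X. z a x = (\<Sum>b<Suc k. ip X (v b) (z a) * v b x)"
        using ku(3) e0 et zt vu by (auto simp: less_Suc_eq v_def)
      thus ?thesis using ku(1) on by (intro exI[of _ "Suc k"] exI[of _ v]) auto
    qed
  qed
  thus ?thesis using that by blast
qed

text \<open>A rectangular matrix and its transpose have the same sums of largest squared singular values:
  the frame on the other side is an orthonormal basis of the span of the images.\<close>

lemma frame_sum_transpose:
  fixes b :: "'x \<Rightarrow> 'y \<Rightarrow> real"
  assumes fin: "finite X" "finite Y"
    and bound: "\<And>k u. k \<le> t \<Longrightarrow> orthonormal X k u \<Longrightarrow>
      (\<Sum>a<k. \<Sum>y\<in>Y. (\<Sum>x\<in>X. b x y * u a x)\<^sup>2) \<le> \<beta>"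
    and w: "orthonormal Y t w"
  shows "(\<Sum>a<t. \<Sum>x\<in>X. (\<Sum>y\<in>Y. b x y * w a y)\<^sup>2) \<le> \<beta>"
proof -
  define z where "z = (\<lambda>a x. \<Sum>y\<in>Y. b x y * w a y)"
  obtain k u where ku: "k \<le> t" "orthonormal X k u"
    "\<And>a x. a < t \<Longrightarrow> x \<in> X \<Longrightarrow> z a x = (\<Sum>c<k. ip X (u c) (z a) * u c x)"
    using gram_schmidt_frame[OF fin(1), of t z] by blast
  define g where "g = (\<lambda>c y. \<Sum>x\<in>X. b x y * u c x)"
  have adj: "ip X (u c) (z a) = ip Y (w a) (g c)" for a c
    unfolding ip_def z_def g_def sum_distrib_left by (subst sum.swap) (simp add: ac_simps)
  have "(\<Sum>x\<in>X. (z a x)\<^sup>2) = (\<Sum>c<k. (ip Y (w a) (g c))\<^sup>2)" if a: "a < t" for a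
  proof -
    have "(\<Sum>x\<in>X. (z a x)\<^sup>2) = ip X (z a) (z a)" by (simp add: ip_def power2_eq_square)
    also have "\<dots> = ip X (\<lambda>x. \<Sum>c<k. ip X (u c) (z a) * u c x) (z a)"
      by (rule ip_cong) (use ku(3)[OF a] in auto)
    also have "\<dots> = (\<Sum>c<k. (ip X (u c) (z a))\<^sup>2)"
      unfolding ip_sum_left ip_scale_left power2_eq_square ..
    finally show ?thesis by (simp add: adj)
  qed
  hence "(\<Sum>a<t. \<Sum>x\<in>X. (z a x)\<^sup>2) = (\<Sum>a<t. \<Sum>c<k. (ip Y (w a) (g c))\<^sup>2)" by simp
  also have "\<dots> = (\<Sum>c<k. \<Sum>a<t. (ip Y (w a) (g c))\<^sup>2)" by (rule sum.swap)
  also have "\<dots> \<le> (\<Sum>c<k. ip Y (g c) (g c))" by (intro sum_mono bessel w)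
  also have "\<dots> = (\<Sum>c<k. \<Sum>y\<in>Y. (g c y)\<^sup>2)" by (simp add: ip_def power2_eq_square)
  also have "\<dots> \<le> \<beta>" unfolding g_def by (rule bound[OF ku(1,2)])
  finally show ?thesis by (simp add: z_def)
qed

section \<open>The spectral theorem\<close>

definition mv :: "'x set \<Rightarrow> ('x \<Rightarrow> 'x \<Rightarrow> real) \<Rightarrow> ('x \<Rightarrow> real) \<Rightarrow> 'x \<Rightarrow> real" where
  "mv X M f x = (\<Sum>y\<in>X. M x y * f y)"

lemma mv_cong: "(\<And>y. y \<in> X \<Longrightarrow> f y = g y) \<Longrightarrow> mv X M f x = mv X M g x"
  by (simp add: mv_def)

lemma mv_add: "mv X M (\<lambda>x. f x + g x) = (\<lambda>x. mv X M f x + mv X M g x)"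
  by (simp add: mv_def fun_eq_iff distrib_left sum.distrib)

lemma mv_scale: "mv X M (\<lambda>x. c * f x) = (\<lambda>x. c * mv X M f x)"
  by (simp add: mv_def fun_eq_iff sum_distrib_left ac_simps)

lemma mv_self_adjoint:
  assumes "\<And>x y. x \<in> X \<Longrightarrow> y \<in> X \<Longrightarrow> M x y = M y x"
  shows "ip X f (mv X M g) = ip X (mv X M f) g"
proof -
  have "ip X f (mv X M g) = (\<Sum>y\<in>X. \<Sum>x\<in>X. f x * (M x y * g y))"
    unfolding ip_def mv_def sum_distrib_left by (rule sum.swap)
  also have "\<dots> = (\<Sum>y\<in>X. \<Sum>x\<in>X. M y x * f x * g y)"
    by (intro sum.cong refl) (simp add: assms)
  finally show ?thesis by (simp add: ip_def mv_def sum_distrib_right)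
qed

text \<open>The projection onto the span has trace \<open>k < card X\<close>, so some diagonal entry
  differs from 1, and the indicator of that point has a nonzero residual.\<close>

lemma orthonormal_extend:
  assumes "finite X" "orthonormal X k u" "k < card X"
  obtains f where "\<And>a. a < k \<Longrightarrow> ip X (u a) f = 0" "ip X f f \<noteq> 0"
proof -
  obtain x where x: "x \<in> X" "(\<Sum>a<k. (u a x)\<^sup>2) \<noteq> 1"
  proof (rule ccontr)
    assume "\<not> thesis"
    hence "\<And>x. x \<in> X \<Longrightarrow> (\<Sum>a<k. (u a x)\<^sup>2) = 1" using that by blast
    hence "(\<Sum>x\<in>X. \<Sum>a<k. (u a x)\<^sup>2) = real (card X)" by simp
    with orthonormal_trace[OF assms(2)] assms(3) show False by simp
  qed
  let ?d = "\<lambda>y. if y = x then 1 else (0::real)"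
  let ?r = "\<lambda>y. ?d y - (\<Sum>a<k. ip X (u a) ?d * u a y)"
  have "ip X ?r ?r = 1 - (\<Sum>a<k. (u a x)\<^sup>2)"
    by (rule trans[OF ip_residual(2)[OF assms(2), of ?d]]) (simp add: ip_indicator assms(1) x(1))
  hence r: "ip X ?r ?r \<noteq> 0" using x(2) by linarith
  show ?thesis by (rule that[of ?r]) (rule ip_residual(1)[OF assms(2)], assumption, rule r)
qed

text \<open>First-order optimality: for small \<open>s\<close> the linear term beats the quadratic
  one. The chosen \<open>s\<close> makes the quadratic term at most half of the linear one.\<close>

lemma quadratic_nonpos_imp_zero:
  fixes R K :: real
  assumes "\<And>s. 2 * s * R \<le> s\<^sup>2 * K" "0 \<le> R"
  shows "R = 0"
proof (rule ccontr)
  assume "R \<noteq> 0"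
  hence R: "R > 0" using assms(2) by simp
  define s where "s = R / (\<bar>K\<bar> + 1)"
  have s: "s > 0" using R by (simp add: s_def)
  have "s\<^sup>2 * K \<le> s * (s * (\<bar>K\<bar> + 1))"
    using s by (simp add: power2_eq_square mult.assoc)
  also have "s * (\<bar>K\<bar> + 1) = R" by (simp add: s_def)
  finally have "2 * s * R \<le> s * R" using assms(1)[of s] by linarith
  thus False using s R by simp
qed

text \<open>The next eigenvector maximizes the quadratic form on the unit sphere of the complement
  of the earlier ones. The maximality is exported because it later yields the order of the
  eigenvalues.\<close>

lemma rayleigh_maximizer:
  assumes fin: "finite X" and sym: "\<And>x y. x \<in> X \<Longrightarrow> y \<in> X \<Longrightarrow> M x y = M y x"
    and on: "orthonormal X k u" and k: "k < card X"
    and eig: "\<And>a x. a < k \<Longrightarrow> x \<in> X \<Longrightarrow> mv X M (u a) x = \<nu> a * u a x"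
  obtains e \<mu> where "ip X e e = 1" "\<And>a. a < k \<Longrightarrow> ip X (u a) e = 0"
    "\<And>x. x \<in> X \<Longrightarrow> mv X M e x = \<mu> * e x"
    "\<And>w. (\<And>a. a < k \<Longrightarrow> ip X (u a) w = 0) \<Longrightarrow> ip X w (mv X M w) \<le> \<mu> * ip X w w"
proof -
  \<comment> \<open>The ambient type may be infinite, so functions are pinned to 0 outside
    \<open>X\<close>; then \<open>S\<close> is a closed subset of a product of compact sets and
    Tychonoff applies.\<close>
  define S where "S = {f. (\<forall>x. x \<notin> X \<longrightarrow> f x = 0) \<and> (\<forall>a<k. ip X (u a) f = 0) \<and> ip X f f = 1}"
  define F where "F = (\<lambda>f. ip X f (mv X M f))"
  have F_scale: "F (\<lambda>x. c * f x) = c\<^sup>2 * F f" for c f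
    by (simp add: F_def mv_scale ip_linear power2_eq_square)
  have coord: "continuous_on A (\<lambda>f. f x)" for A :: "('a \<Rightarrow> real) set" and x
    by (rule continuous_on_subset[OF continuous_on_product_coordinates]) simp
  have contF: "continuous_on A F" for A
    unfolding F_def ip_def mv_def by (intro continuous_intros coord)
  have normalize: "\<exists>g\<in>S. F g * ip X f f = F f"
    if f: "\<And>a. a < k \<Longrightarrow> ip X (u a) f = 0" "ip X f f \<noteq> 0" for f
  proof -
    define n where "n = sqrt (ip X f f)"
    have n: "n > 0" "n\<^sup>2 = ip X f f" using f(2) ip_self_nonneg[of X f] by (auto simp: n_def)
    define h where "h = (\<lambda>x. (1 / n) * f x)"
    define g where "g = (\<lambda>x. if x \<in> X then h x else 0)"
    have gh: "ip X p g = ip X p h" "ip X g p = ip X h p" for p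
      by (auto intro!: ip_cong simp: g_def)
    have "mv X M g x = mv X M h x" for x by (rule mv_cong) (simp add: g_def)
    hence "mv X M g = mv X M h" by blast
    hence Fg: "F g = F h" by (simp add: F_def gh)
    have "ip X h h = (1 / n)\<^sup>2 * ip X f f"
      unfolding h_def ip_scale_left ip_scale_right by (simp add: power2_eq_square)
    hence hh: "ip X h h = 1" unfolding n(2)[symmetric] using n(1) by (simp add: power_divide)
    have "ip X (u a) h = 0" if "a < k" for a unfolding h_def ip_scale_right f(1)[OF that] by simp
    hence "g \<in> S" by (simp add: S_def gh hh) (simp add: g_def)
    moreover have "F g * ip X f f = F f"
      unfolding Fg n(2)[symmetric] unfolding h_def F_scale using n(1) by (simp add: field_simps)
    ultimately show ?thesis by blast
  qed
  obtain f0 where f0: "\<And>a. a < k \<Longrightarrow> ip X (u a) f0 = 0" "ip X f0 f0 \<noteq> 0"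
    using orthonormal_extend[OF fin on k] by blast
  have "S \<noteq> {}" using normalize[OF f0] by blast
  have "compact S"
  proof -
    let ?B = "\<lambda>x. if x \<in> X then {-1..1::real} else {0}"
    have "compactin (product_topology (\<lambda>_. euclidean) UNIV) (PiE UNIV ?B)"
      unfolding compactin_PiE by simp
    hence B: "compact (PiE UNIV ?B)" by (simp add: euclidean_product_topology)
    have C1: "closed {f. \<forall>x. x \<notin> X \<longrightarrow> f x = (0::real)}"
      unfolding Collect_all_eq Collect_imp_eq
      by (intro closed_INT ballI closed_Un closed_Collect_eq coord continuous_on_const) auto
    have C2: "closed {f. \<forall>a<k. ip X (u a) f = 0}"
      unfolding Collect_all_eq Collect_imp_eq ip_def
      by (intro closed_INT ballI closed_Un closed_Collect_eq coord continuous_intros) auto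
    have C3: "closed {f. ip X f f = 1}"
      unfolding ip_def by (intro closed_Collect_eq coord continuous_intros)
    have "closed S"
      using closed_Int[OF C1 closed_Int[OF C2 C3]] by (simp add: S_def Collect_conj_eq)
    moreover have "S \<subseteq> PiE UNIV ?B"
    proof
      fix f assume f: "f \<in> S"
      have "f x \<in> {-1..1}" if "x \<in> X" for x
      proof -
        have "(f x)\<^sup>2 \<le> ip X f f"
          using member_le_sum[OF that, of "\<lambda>x. (f x)\<^sup>2"] fin by (simp add: ip_def power2_eq_square)
        hence "\<bar>f x\<bar> \<le> 1" using f by (simp add: S_def abs_square_le_1)
        thus ?thesis by auto
      qed
      thus "f \<in> PiE UNIV ?B" using f by (auto simp: S_def)
    qed
    ultimately show ?thesis using compact_Int_closed[OF B, of S] by (simp add: Int_absorb1)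
  qed
  obtain e where e: "e \<in> S" "\<And>f. f \<in> S \<Longrightarrow> F f \<le> F e"
    using continuous_attains_sup[OF \<open>compact S\<close> \<open>S \<noteq> {}\<close> contF] by blast
  have ee: "ip X e e = 1" and ue: "\<And>a. a < k \<Longrightarrow> ip X (u a) e = 0" using e(1) by (auto simp: S_def)
  have max: "F w \<le> F e * ip X w w" if w: "\<And>a. a < k \<Longrightarrow> ip X (u a) w = 0" for w
  proof (cases "ip X w w = 0")
    case True
    hence "\<forall>x\<in>X. w x = 0" using fin by (simp add: ip_self_eq_0)
    hence "F w = 0" by (simp add: F_def ip_def)
    thus ?thesis using True by simp
  next
    case False
    then obtain g where g: "g \<in> S" "F g * ip X w w = F w" using normalize[OF w] by blast
    thus ?thesis using mult_right_mono[OF e(2)[OF g(1)] ip_self_nonneg, of X w] by simp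
  qed
  define r where "r = (\<lambda>x. mv X M e x - F e * e x)"
  have ur: "ip X (u a) r = 0" if a: "a < k" for a
  proof -
    have "ip X (u a) (mv X M e) = ip X (mv X M (u a)) e" by (rule mv_self_adjoint[OF sym])
    also have "\<dots> = ip X (\<lambda>x. \<nu> a * u a x) e" by (rule ip_cong) (use eig[OF a] in auto)
    also have "\<dots> = 0" using ue[OF a] by (simp add: ip_linear)
    finally show ?thesis unfolding r_def ip_linear using ue[OF a] by simp
  qed
  have er: "ip X e r = 0" unfolding r_def ip_linear ee by (simp add: F_def)
  have rMe: "ip X r (mv X M e) = ip X r r"
  proof -
    have "ip X r r = ip X r (mv X M e) - F e * ip X r e"
      by (subst (2) r_def) (simp only: ip_linear)
    thus ?thesis using er by (simp add: ip_commute[of X r e])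
  qed
  \<comment> \<open>The residual \<open>r\<close> is orthogonal to the earlier eigenvectors by
    self-adjointness, so \<open>e + s r\<close> is an admissible competitor; its first-order gain is
    \<open>2 s\<close> times the squared norm of \<open>r\<close>, and maximality of
    \<open>e\<close> forbids a gain.\<close>
  have "2 * s * ip X r r \<le> s\<^sup>2 * (F e * ip X r r - F r)" for s
  proof -
    let ?w = "\<lambda>x. e x + s * r x"
    have ww: "ip X ?w ?w = 1 + s\<^sup>2 * ip X r r"
      by (simp add: ip_linear ee er ip_commute[of X r e] power2_eq_square)
    have "ip X e (mv X M r) = ip X r r"
      by (subst mv_self_adjoint[OF sym]) (simp_all add: ip_commute[of X "mv X M e" r] rMe)
    hence "F ?w = F e + 2 * s * ip X r r + s\<^sup>2 * F r"
      by (simp add: F_def mv_add mv_scale ip_linear rMe power2_eq_square algebra_simps)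
    moreover have "F ?w \<le> F e * ip X ?w ?w"
      by (rule max) (simp add: ip_linear ue ur)
    ultimately show ?thesis unfolding ww by (simp add: algebra_simps)
  qed
  hence "ip X r r = 0" by (rule quadratic_nonpos_imp_zero[OF _ ip_self_nonneg])
  hence "\<forall>x\<in>X. r x = 0" using fin by (simp add: ip_self_eq_0)
  hence "\<And>x. x \<in> X \<Longrightarrow> mv X M e x = F e * e x" by (simp add: r_def)
  thus ?thesis using that[OF ee ue _ max[unfolded F_def]] by (simp add: F_def)
qed

theorem spectral_frame:
  assumes fin: "finite X" and sym: "\<And>x y. x \<in> X \<Longrightarrow> y \<in> X \<Longrightarrow> M x y = M y x"
  obtains u \<nu> where "orthonormal X (card X) u"
    "\<And>a x. a < card X \<Longrightarrow> x \<in> X \<Longrightarrow> mv X M (u a) x = \<nu> a * u a x"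
    "\<And>a b. a \<le> b \<Longrightarrow> b < card X \<Longrightarrow> \<nu> b \<le> \<nu> a"
proof -
  have "\<exists>u \<nu>. orthonormal X k u \<and> (\<forall>a<k. \<forall>x\<in>X. mv X M (u a) x = \<nu> a * u a x) \<and>
      (\<forall>a<k. \<forall>w. (\<forall>b<a. ip X (u b) w = 0) \<longrightarrow> ip X w (mv X M w) \<le> \<nu> a * ip X w w)"
    if "k \<le> card X" for k
    using that
  proof (induction k)
    case 0
    show ?case by (simp add: orthonormal_def)
  next
    case (Suc k)
    hence "k \<le> card X" by simp
    then obtain u \<nu> where IH: "orthonormal X k u"
      "\<forall>a<k. \<forall>x\<in>X. mv X M (u a) x = \<nu> a * u a x"
      "\<forall>a<k. \<forall>w. (\<forall>b<a. ip X (u b) w = 0) \<longrightarrow> ip X w (mv X M w) \<le> \<nu> a * ip X w w"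
      using Suc.IH by blast
    have IH2: "\<And>a x. a < k \<Longrightarrow> x \<in> X \<Longrightarrow> mv X M (u a) x = \<nu> a * u a x" using IH(2) by blast
    obtain e \<mu> where e: "ip X e e = 1" "\<And>a. a < k \<Longrightarrow> ip X (u a) e = 0"
      "\<And>x. x \<in> X \<Longrightarrow> mv X M e x = \<mu> * e x"
      "\<And>w. (\<And>a. a < k \<Longrightarrow> ip X (u a) w = 0) \<Longrightarrow> ip X w (mv X M w) \<le> \<mu> * ip X w w"
      using rayleigh_maximizer[OF fin sym IH(1) Suc_le_lessD[OF Suc.prems] IH2] by blast
    have e2: "\<And>a. a < k \<Longrightarrow> ip X e (u a) = 0"
      by (subst ip_commute) (rule e(2))
    let ?u = "u(k := e)" and ?\<nu> = "\<nu>(k := \<mu>)"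
    have "orthonormal X (Suc k) ?u"
      using IH(1) e(1,2) e2 by (auto simp: orthonormal_def less_Suc_eq)
    moreover have "\<forall>a<Suc k. \<forall>x\<in>X. mv X M (?u a) x = ?\<nu> a * ?u a x"
      using IH2 e(3) by (auto simp: less_Suc_eq)
    moreover have "\<forall>a<Suc k. \<forall>w. (\<forall>b<a. ip X (?u b) w = 0) \<longrightarrow> ip X w (mv X M w) \<le> ?\<nu> a * ip X w w"
      using IH(3) e(4) by (auto simp: less_Suc_eq)
    ultimately show ?case by blast
  qed
  from this[OF order_refl] obtain u \<nu> where u: "orthonormal X (card X) u"
    "\<And>a x. a < card X \<Longrightarrow> x \<in> X \<Longrightarrow> mv X M (u a) x = \<nu> a * u a x"
    "\<And>a w. a < card X \<Longrightarrow> (\<And>b. b < a \<Longrightarrow> ip X (u b) w = 0) \<Longrightarrow> ip X w (mv X M w) \<le> \<nu> a * ip X w w"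
    by blast
  have "\<nu> b \<le> \<nu> a" if ab: "a \<le> b" "b < card X" for a b
  proof -
    have "ip X (u b) (mv X M (u b)) = ip X (u b) (\<lambda>x. \<nu> b * u b x)"
      by (rule ip_cong) (use u(2) ab in auto)
    hence "ip X (u b) (mv X M (u b)) = \<nu> b"
      using u(1) ab by (simp add: ip_linear orthonormal_def)
    \<comment> \<open>Since \<open>a \<le> b\<close>, the vector \<open>u b\<close> competed in the
      maximization that produced \<open>\<nu> a\<close>.\<close>
    moreover have "ip X (u b) (mv X M (u b)) \<le> \<nu> a * ip X (u b) (u b)"
      by (rule u(3)) (use u(1) ab in \<open>auto simp: orthonormal_def\<close>)
    ultimately show ?thesis using u(1) ab by (simp add: orthonormal_def)
  qed
  thus ?thesis using that u(1,2) by blast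
qed

section \<open>Determinants of forests\<close>

text \<open>The function \<open>w i\<close> is the \<open>i\<close>-th column, so replacing a column
  is a function update.\<close>

definition cdet :: "nat \<Rightarrow> (nat \<Rightarrow> nat \<Rightarrow> real) \<Rightarrow> real" where
  "cdet n w = det (mat n n (\<lambda>(a, i). w i a))"

text \<open>The coefficients are the cofactors of column \<open>i\<close>. One vector
  \<open>q\<close> serves all replacements, so the determinant becomes a fixed linear functional of
  that column.\<close>

lemma cdet_linear:
  assumes "i < n"
  obtains q where "\<And>y. cdet n (w(i := y)) = (\<Sum>a<n. y a * q a)"
proof -
  have "cdet n (w(i := y)) = (\<Sum>a<n. y a * cofactor (mat n n (\<lambda>(a, i). w i a)) a i)" for y
  proof -
    let ?A = "mat n n (\<lambda>(a, k). (w(i := y)) k a)"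
    have "cofactor ?A a i = cofactor (mat n n (\<lambda>(a, i). w i a)) a i" for a
    proof -
      have "mat_delete ?A a i = mat_delete (mat n n (\<lambda>(a, i). w i a)) a i"
        unfolding mat_delete_def using assms by (intro eq_matI) auto
      thus ?thesis by (simp add: cofactor_def)
    qed
    thus ?thesis
      unfolding cdet_def using assms by (subst laplace_expansion_column[of _ n i]) auto
  qed
  thus ?thesis by (rule that)
qed

lemma cdet_same_columns:
  assumes "i < n" "k < n" "i \<noteq> k"
  shows "cdet n (w(i := w k)) = 0"
  unfolding cdet_def using assms by (intro det_identical_columns[of _ n i k] eq_vecI) auto

lemma cdet_swap:
  assumes "i < n" "k < n" "i \<noteq> k"
  shows "cdet n (w(i := y, k := z)) = - cdet n (w(i := z, k := y))"
proof -
  have add_k: "cdet n (v(k := \<lambda>a. y a + z a)) = cdet n (v(k := y)) + cdet n (v(k := z))" for v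
  proof -
    obtain q where "\<And>y. cdet n (v(k := y)) = (\<Sum>a<n. y a * q a)" using cdet_linear[OF assms(2), where w = v] by blast
    thus ?thesis by (simp add: distrib_right sum.distrib)
  qed
  have add_i: "cdet n (v(i := \<lambda>a. y a + z a)) = cdet n (v(i := y)) + cdet n (v(i := z))" for v
  proof -
    obtain q where "\<And>y. cdet n (v(i := y)) = (\<Sum>a<n. y a * q a)" using cdet_linear[OF assms(1), where w = v] by blast
    thus ?thesis by (simp add: distrib_right sum.distrib)
  qed
  have zero: "cdet n (w(i := x, k := x)) = 0" for x
    using cdet_same_columns[OF assms, of "w(k := x)"] assms(3) by (simp add: fun_upd_twist)
  let ?s = "\<lambda>a. y a + z a"
  have "0 = cdet n (w(i := ?s, k := ?s))" by (simp add: zero)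
  also have "\<dots> = cdet n (w(i := ?s, k := y)) + cdet n (w(i := ?s, k := z))" by (rule add_k)
  also have "\<dots> = cdet n (w(k := y, i := ?s)) + cdet n (w(k := z, i := ?s))"
    using assms(3) by (simp add: fun_upd_twist)
  also have "\<dots> = cdet n (w(k := y, i := y)) + cdet n (w(k := y, i := z))
      + (cdet n (w(k := z, i := y)) + cdet n (w(k := z, i := z)))"
    by (simp only: add_i)
  also have "\<dots> = cdet n (w(i := y, k := z)) + cdet n (w(i := z, k := y))"
    using assms(3) zero by (simp add: fun_upd_twist[of k i])
  finally show ?thesis by simp
qed

text \<open>A diagonal matrix acts on the top exterior power, as a derivation, by its trace: in each
  permutation term the factors \<open>l (p i)\<close> add up over \<open>i\<close> to the sum of all
  \<open>l a\<close>.\<close>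

lemma cdet_trace:
  "(\<Sum>i<n. cdet n (w(i := \<lambda>a. l a * w i a))) = (\<Sum>a<n. l a) * cdet n w"
proof -
  have D: "cdet n v = (\<Sum>p | p permutes {0..<n}. signof p * (\<Prod>j<n. v j (p j)))" for v
  proof -
    have "cdet n v = (\<Sum>p | p permutes {0..<n}. signof p *
        (\<Prod>j<n. mat n n (\<lambda>(a, i). v i a) $$ (p j, j)))"
      unfolding cdet_def by (rule det_col) simp
    also have "\<dots> = (\<Sum>p | p permutes {0..<n}. signof p * (\<Prod>j<n. v j (p j)))"
    proof (intro sum.cong refl arg_cong2[where f = "(*)"] prod.cong)
      fix p j assume "p \<in> {p. p permutes {0..<n}}" "j \<in> {..<n}"
      thus "mat n n (\<lambda>(a, i). v i a) $$ (p j, j) = v j (p j)"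
        using permutes_in_image[of p "{0..<n}" j] by simp
    qed
    finally show ?thesis .
  qed
  have P: "(\<Prod>j<n. (w(i := \<lambda>a. l a * w i a)) j (p j)) = l (p i) * (\<Prod>j<n. w j (p j))"
    if "i < n" for i p
    using that by (subst (1 2) prod.remove[of _ i]) auto
  have "(\<Sum>i<n. cdet n (w(i := \<lambda>a. l a * w i a)))
      = (\<Sum>p | p permutes {0..<n}. \<Sum>i<n. signof p * (l (p i) * (\<Prod>j<n. w j (p j))))"
    unfolding D by (subst sum.swap) (intro sum.cong refl, simp only: P lessThan_iff)
  also have "\<dots> = (\<Sum>p | p permutes {0..<n}. (\<Sum>a<n. l a) * (signof p * (\<Prod>j<n. w j (p j))))"
  proof (intro sum.cong refl)
    fix p assume "p \<in> {p. p permutes {0..<n}}"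
    hence "(\<Sum>i<n. l (p i)) = (\<Sum>a<n. l a)"
      using sum.permute[of p "{0..<n}" l] by (simp add: atLeast0LessThan)
    thus "(\<Sum>i<n. signof p * (l (p i) * (\<Prod>j<n. w j (p j)))) =
        (\<Sum>a<n. l a) * (signof p * (\<Prod>j<n. w j (p j)))"
      by (simp add: sum_distrib_left[symmetric] sum_distrib_right[symmetric] ac_simps)
  qed
  also have "\<dots> = (\<Sum>a<n. l a) * cdet n w" by (simp add: D sum_distrib_left)
  finally show ?thesis .
qed

text \<open>Steinitz exchange: starting from the identity matrix, columns are replaced one at a time
  by differences between a vertex of \<open>C\<close> and a vertex of \<open>D\<close>, keeping the
  determinant nonzero. The functions \<open>u a\<close> are independent and orthogonal to the
  constants, which keeps the exchange from getting stuck.\<close>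

lemma forest_determinant_nonzero:
  fixes u :: "nat \<Rightarrow> 'v \<Rightarrow> real"
  assumes fin: "finite C" "finite D" and dis: "C \<inter> D = {}" and ne: "D \<noteq> {}"
    and e: "bij_betw e {..<n} C"
    and on: "orthonormal (C \<union> D) n u"
    and sum0: "\<And>a. a < n \<Longrightarrow> (\<Sum>v\<in>C \<union> D. u a v) = 0"
  obtains f where "f \<in> {..<n} \<rightarrow>\<^sub>E D" "cdet n (\<lambda>i a. u a (e i) - u a (f i)) \<noteq> 0"
proof -
  have "\<exists>S f w. S \<subseteq> {..<n} \<and> card S = k \<and> cdet n w \<noteq> 0 \<and>
      (\<forall>i\<in>S. f i \<in> D \<and> w i = (\<lambda>a. u a (e i) - u a (f i)))" if "k \<le> n" for k
    using that
  proof (induction k)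
    case 0
    have "mat n n (\<lambda>(a, i). if a = i then 1 else 0) = (1\<^sub>m n :: real mat)" by (intro eq_matI) auto
    hence "cdet n (\<lambda>i a. if a = i then 1 else 0) \<noteq> 0" by (simp add: cdet_def)
    thus ?case by (intro exI[of _ "{}"] exI) auto
  next
    case (Suc k)
    hence "k \<le> n" by simp
    from Suc.IH[OF this] obtain S f w where IH: "S \<subseteq> {..<n}" "card S = k" "cdet n w \<noteq> 0"
      "\<And>i. i \<in> S \<Longrightarrow> f i \<in> D" "\<And>i. i \<in> S \<Longrightarrow> w i = (\<lambda>a. u a (e i) - u a (f i))"
      by blast
    have "S \<noteq> {..<n}" using IH(2) Suc.prems by auto
    then obtain i0 where i0: "i0 < n" "i0 \<notin> S" using IH(1) by blast
    obtain q where q: "\<And>y. cdet n (w(i0 := y)) = (\<Sum>a<n. y a * q a)"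
      using cdet_linear[OF i0(1), where w = w] by blast
    \<comment> \<open>\<open>G x - G y\<close> is the determinant after the unprocessed column
      \<open>i0\<close> is replaced by the difference for \<open>x\<close> and
      \<open>y\<close>.\<close>
    define G where "G = (\<lambda>v. \<Sum>a<n. u a v * q a)"
    have G_diff: "(\<Sum>a<n. (u a x - u a y) * q a) = G x - G y" for x y
      by (simp add: G_def left_diff_distrib sum_subtractf)
    have GS: "G (e i) = G (f i)" if "i \<in> S" for i
    proof -
      have i: "i < n" "i0 \<noteq> i" using that IH(1) i0 by auto
      have "cdet n (w(i0 := w i)) = 0" using i0(1) i by (rule cdet_same_columns)
      hence "(\<Sum>a<n. (u a (e i) - u a (f i)) * q a) = 0" by (simp add: q IH(5)[OF that])
      thus ?thesis by (simp add: G_diff)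
    qed
    \<comment> \<open>Otherwise \<open>G\<close> is constant on \<open>C \<union> D\<close>, hence
      zero because every \<open>u a\<close> has sum zero; independence of the \<open>u a\<close>
      then gives \<open>q = 0\<close>, against \<open>cdet n w \<noteq> 0\<close>.\<close>
    have "\<exists>i<n. i \<notin> S \<and> (\<exists>j\<in>D. G (e i) \<noteq> G j)"
    proof (rule ccontr)
      assume "\<not> ?thesis"
      hence all: "\<And>i j. i < n \<Longrightarrow> i \<notin> S \<Longrightarrow> j \<in> D \<Longrightarrow> G (e i) = G j" by blast
      define \<kappa> where "\<kappa> = G (e i0)"
      have GD: "G j = \<kappa>" if "j \<in> D" for j using all[OF i0 that] by (simp add: \<kappa>_def)
      have "G (e i) = \<kappa>" if "i < n" for i
      proof (cases "i \<in> S")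
        case True
        thus ?thesis using GS GD IH(4) by metis
      next
        case False
        obtain j where "j \<in> D" using ne by blast
        thus ?thesis using all[OF that False] GD by metis
      qed
      hence GV: "G v = \<kappa>" if "v \<in> C \<union> D" for v
        using that GD e by (auto simp: bij_betw_def)
      have "(\<Sum>v\<in>C \<union> D. G v) = (\<Sum>a<n. (\<Sum>v\<in>C \<union> D. u a v) * q a)"
        unfolding G_def sum_distrib_right by (rule sum.swap)
      also have "\<dots> = 0" using sum0 by simp
      finally have "\<kappa> = 0" using GV fin ne by auto
      hence "G v = 0" if "v \<in> C \<union> D" for v using GV[OF that] by simp
      have "q b = 0" if b: "b < n" for b
      proof -
        have "ip (C \<union> D) (u b) G = (\<Sum>a<n. q a * ip (C \<union> D) (u b) (u a))"
          unfolding G_def by (simp add: ip_def sum_distrib_left sum_distrib_right sum.swap[of _ "C \<union> D"] ac_simps)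
        also have "\<dots> = (\<Sum>a<n. if a = b then q a else 0)"
          by (rule sum.cong) (use on b in \<open>auto simp: orthonormal_def\<close>)
        also have "\<dots> = q b" using b by simp
        finally show ?thesis using \<open>\<And>v. v \<in> C \<union> D \<Longrightarrow> G v = 0\<close> by (simp add: ip_def)
      qed
      hence "cdet n (w(i0 := w i0)) = 0" unfolding q by simp
      thus False using IH(3) by simp
    qed
    then obtain i j where ij: "i < n" "i \<notin> S" "j \<in> D" "G (e i) \<noteq> G j" by blast
    let ?y = "\<lambda>a. u a (e i) - u a j"
    have nz: "cdet n (w(i0 := ?y)) \<noteq> 0" unfolding q G_diff using ij(4) by simp
    \<comment> \<open>The freed slot is \<open>i0\<close>, but the difference for \<open>e i\<close>
      belongs in slot \<open>i\<close>; interchanging the two columns costs only a sign.\<close>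
    define w' where "w' = w(i0 := w i, i := ?y)"
    have "cdet n w' \<noteq> 0"
    proof (cases "i = i0")
      case True
      thus ?thesis using nz by (simp add: w'_def)
    next
      case False
      have "cdet n w' = - cdet n (w(i0 := ?y, i := w i))"
        unfolding w'_def by (rule cdet_swap) (use False i0 ij in auto)
      also have "w(i0 := ?y, i := w i) = w(i0 := ?y)" using False by (simp add: fun_eq_iff)
      finally show ?thesis using nz by (simp del: fun_upd_apply)
    qed
    moreover have "\<forall>l\<in>insert i S. (f(i := j)) l \<in> D \<and> w' l = (\<lambda>a. u a (e l) - u a ((f(i := j)) l))"
      using IH(4,5) ij i0 by (auto simp: w'_def)
    moreover have "card (insert i S) = Suc k" "insert i S \<subseteq> {..<n}"
      using IH(1,2) ij finite_subset[OF IH(1)] by auto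
    ultimately show ?case by blast
  qed
  from this[OF order_refl] obtain S f w where *: "S \<subseteq> {..<n}" "card S = n" "cdet n w \<noteq> 0"
      "\<And>i. i \<in> S \<Longrightarrow> f i \<in> D" "\<And>i. i \<in> S \<Longrightarrow> w i = (\<lambda>a. u a (e i) - u a (f i))" by blast
  have S: "S = {..<n}" using *(1,2) by (intro card_subset_eq) auto
  have "cdet n (\<lambda>i a. u a (e i) - u a (restrict f {..<n} i)) = cdet n w"
    unfolding cdet_def using *(5) S by (intro arg_cong[where f = det] cong_mat) auto
  thus ?thesis using that[of "restrict f {..<n}"] *(3,4) S by auto
qed

section \<open>The Grone-Merris inequality\<close>

text \<open>The Laplacian of a weighted graph. In this difference form loops contribute zero, so a
  clique can carry weight 1 on the diagonal as well, and \<open>1 - A\<close> is again a graph of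
  the same kind.\<close>

definition lap :: "'v set \<Rightarrow> ('v \<Rightarrow> 'v \<Rightarrow> real) \<Rightarrow> ('v \<Rightarrow> real) \<Rightarrow> 'v \<Rightarrow> real" where
  "lap V A f x = (\<Sum>y\<in>V. A x y * (f x - f y))"

text \<open>Replacing column \<open>i\<close> by the difference for \<open>x\<close> and
  \<open>y\<close> gives the signed determinant \<open>G x - G y\<close>, for a function
  \<open>G\<close> on the vertices. Maximality makes \<open>f i\<close> a minimum of
  \<open>G\<close> on the whole vertex set, and \<open>G (e i)\<close> lies exactly
  \<open>\<psi>\<close> above it. The eigenvalue equation expresses the expanded term through
  Laplacians of \<open>G\<close>, where these bounds on differences apply.\<close>

lemma split_graph_eigensum:
  fixes u :: "nat \<Rightarrow> 'v \<Rightarrow> real"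
  assumes fin: "finite C" "finite D" and dis: "C \<inter> D = {}" and ne: "D \<noteq> {}"
    and A_sym: "\<And>x y. A x y = A y x"
    and A_bounds: "\<And>x y. 0 \<le> A x y" "\<And>x y. A x y \<le> 1"
    and A_C: "\<And>x y. x \<in> C \<Longrightarrow> y \<in> C \<Longrightarrow> A x y = 1"
    and A_D: "\<And>x y. x \<in> D \<Longrightarrow> y \<in> D \<Longrightarrow> A x y = 0"
    and n: "n = card C"
    and on: "orthonormal (C \<union> D) n u"
    and sum0: "\<And>a. a < n \<Longrightarrow> (\<Sum>v\<in>C \<union> D. u a v) = 0"
    and eig: "\<And>a v. a < n \<Longrightarrow> v \<in> C \<union> D \<Longrightarrow> lap (C \<union> D) A (u a) v = l a * u a v"
  shows "(\<Sum>a<n. l a) \<le> real (n * n) + (\<Sum>x\<in>C. \<Sum>y\<in>D. A x y)"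
proof -
  obtain e where e: "bij_betw e {..<n} C"
    using ex_bij_betw_nat_finite[OF fin(1)] by (auto simp: n atLeast0LessThan)
  have eC: "e i \<in> C" if "i < n" for i using e that by (auto simp: bij_betw_def)
  define W where "W = (\<lambda>f i a. u a (e i) - u a (f i :: 'v))"
  define \<Phi> where "\<Phi> = {..<n} \<rightarrow>\<^sub>E D"
  have fin\<Phi>: "finite \<Phi>" unfolding \<Phi>_def using fin by (intro finite_PiE) auto
  obtain f0 where f0: "f0 \<in> \<Phi>" "cdet n (W f0) \<noteq> 0"
    using forest_determinant_nonzero[OF fin dis ne e on sum0] unfolding W_def \<Phi>_def by blast
  have "Max ((\<lambda>f. \<bar>cdet n (W f)\<bar>) ` \<Phi>) \<in> (\<lambda>f. \<bar>cdet n (W f)\<bar>) ` \<Phi>"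
    using fin\<Phi> f0(1) by (intro Max_in) auto
  then obtain f where f: "f \<in> \<Phi>" "\<bar>cdet n (W f)\<bar> = Max ((\<lambda>f. \<bar>cdet n (W f)\<bar>) ` \<Phi>)" by auto
  have fmax: "\<bar>cdet n (W g)\<bar> \<le> \<bar>cdet n (W f)\<bar>" if "g \<in> \<Phi>" for g
    unfolding f(2) using fin\<Phi> that by (intro Max_ge) auto
  have fD: "f i \<in> D" if "i < n" for i using f(1) that by (auto simp: \<Phi>_def)
  define \<epsilon> where "\<epsilon> = sgn (cdet n (W f))"
  define \<psi> where "\<psi> = \<bar>cdet n (W f)\<bar>"
  have \<psi>: "\<psi> > 0" using fmax[OF f0(1)] f0(2) by (simp add: \<psi>_def)
  have \<epsilon>\<psi>: "\<epsilon> * cdet n (W f) = \<psi>" by (simp add: \<epsilon>_def \<psi>_def abs_sgn mult.commute)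
  have \<epsilon>_le: "\<epsilon> * cdet n (W g) \<le> \<psi>" if "g \<in> \<Phi>" for g
    using fmax[OF that] by (auto simp: \<epsilon>_def \<psi>_def sgn_if split: if_splits)
  have column: "\<epsilon> * cdet n ((W f)(i := \<lambda>a. l a * W f i a)) \<le> (real n + (\<Sum>y\<in>D. A (e i) y)) * \<psi>"
    if i: "i < n" for i
  proof -
    obtain q where q: "\<And>y. cdet n ((W f)(i := y)) = (\<Sum>a<n. y a * q a)"
      using cdet_linear[OF i, where w = "W f"] by blast
    define G where "G = (\<lambda>v. \<epsilon> * (\<Sum>a<n. u a v * q a))"
    have G_diff: "\<epsilon> * cdet n ((W f)(i := \<lambda>a. u a x - u a y)) = G x - G y" for x y
      unfolding q G_def by (simp add: left_diff_distrib sum_subtractf right_diff_distrib)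
    define x where "x = e i"
    define j where "j = f i"
    have xj: "x \<in> C" "j \<in> D" using eC fD i by (auto simp: x_def j_def)
    have Gxj: "G x - G j = \<psi>"
    proof -
      have "(W f)(i := \<lambda>a. u a x - u a j) = W f" by (simp add: W_def x_def j_def fun_eq_iff)
      thus ?thesis using G_diff[of x j] \<epsilon>\<psi> by simp
    qed
    have GD: "G j \<le> G y" if y: "y \<in> D" for y
    proof -
      have "(W f)(i := \<lambda>a. u a x - u a y) = W (f(i := y))"
        by (simp add: W_def x_def fun_eq_iff)
      moreover have "f(i := y) \<in> \<Phi>" using f(1) i y by (auto simp: \<Phi>_def PiE_def extensional_def)
      ultimately have "G x - G y \<le> \<psi>" using G_diff[of x y] \<epsilon>_le by metis
      thus ?thesis using Gxj by simp
    qed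
    \<comment> \<open>Here no change of \<open>f\<close> produces the comparison. Instead, column
      \<open>k\<close> already occurs, so a repeated column gives \<open>G y = G (f k)\<close>, and
      the bound on \<open>D\<close> applies.\<close>
    have GC: "G j \<le> G y" if y: "y \<in> C" for y
    proof (cases "y = x")
      case True
      thus ?thesis using Gxj \<psi> by simp
    next
      case False
      obtain k where k: "k < n" "y = e k" using y e by (auto simp: bij_betw_def)
      have ki: "i \<noteq> k" using False k by (auto simp: x_def)
      have "\<epsilon> * cdet n ((W f)(i := W f k)) = 0" using cdet_same_columns[OF i k(1) ki] by simp
      moreover have "W f k = (\<lambda>a. u a y - u a (f k))" by (simp add: W_def k)
      ultimately have "G y = G (f k)" using G_diff[of y "f k"] by simp
      thus ?thesis using GD[OF fD[OF k(1)]] by simp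
    qed
    \<comment> \<open>The eigenvalue equation turns the scaling of coordinate \<open>a\<close> by
      \<open>l a\<close> into the Laplacian acting on \<open>G\<close>.\<close>
    have G_lap: "(\<Sum>a<n. l a * u a v * q a) * \<epsilon> = (\<Sum>y\<in>C \<union> D. A v y * (G v - G y))"
      if v: "v \<in> C \<union> D" for v
    proof -
      have "(\<Sum>a<n. l a * u a v * q a) = (\<Sum>a<n. \<Sum>y\<in>C \<union> D. A v y * (u a v - u a y) * q a)"
        by (rule sum.cong) (use eig v in \<open>auto simp: lap_def sum_distrib_right[symmetric]\<close>)
      also have "\<dots> = (\<Sum>y\<in>C \<union> D. \<Sum>a<n. A v y * (u a v - u a y) * q a)" by (rule sum.swap)
      finally show ?thesis
        by (simp add: G_def sum_distrib_left sum_distrib_right sum_subtractf[symmetric] algebra_simps)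
    qed
    have "\<epsilon> * cdet n ((W f)(i := \<lambda>a. l a * W f i a)) =
        (\<Sum>a<n. l a * u a x * q a) * \<epsilon> - (\<Sum>a<n. l a * u a j * q a) * \<epsilon>"
      unfolding q by (simp add: W_def x_def j_def algebra_simps sum_subtractf)
    also have "\<dots> = (\<Sum>y\<in>C \<union> D. A x y * (G x - G y)) - (\<Sum>y\<in>C \<union> D. A j y * (G j - G y))"
      using G_lap xj by simp
    also have "\<dots> = (\<Sum>y\<in>C. (G x - G y) - A j y * (G j - G y)) + (\<Sum>y\<in>D. A x y * (G x - G y))"
      using fin dis xj A_C A_D by (simp add: sum.union_disjoint sum_subtractf)
    also have "\<dots> \<le> (\<Sum>y\<in>C. \<psi>) + (\<Sum>y\<in>D. A x y * \<psi>)"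
    proof (intro add_mono sum_mono mult_left_mono A_bounds)
      fix y assume y: "y \<in> C"
      \<comment> \<open>Because \<open>A j y \<le> 1\<close> and \<open>G j \<le> G y\<close>, the
        term of \<open>j\<close> adds at most \<open>G y - G j\<close>, which completes
        \<open>G x - G y\<close> to \<open>G x - G j = \<psi>\<close>.\<close>
      have "(1 - A j y) * (G j - G y) \<le> 0"
        using GC[OF y] A_bounds[of j y] by (simp add: mult_nonneg_nonpos)
      thus "(G x - G y) - A j y * (G j - G y) \<le> \<psi>" using Gxj by (simp add: algebra_simps)
    next
      fix y assume "y \<in> D"
      thus "G x - G y \<le> \<psi>" using GD Gxj by force
    qed
    also have "\<dots> = (real n + (\<Sum>y\<in>D. A x y)) * \<psi>"
      by (simp add: n distrib_right sum_distrib_right)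
    finally show ?thesis by (simp add: x_def)
  qed
  have "(\<Sum>a<n. l a) * \<psi> = \<epsilon> * ((\<Sum>a<n. l a) * cdet n (W f))" using \<epsilon>\<psi> by (simp add: ac_simps)
  also have "\<dots> = (\<Sum>i<n. \<epsilon> * cdet n ((W f)(i := \<lambda>a. l a * W f i a)))"
    by (simp only: cdet_trace[symmetric] sum_distrib_left)
  also have "\<dots> \<le> (\<Sum>i<n. (real n + (\<Sum>y\<in>D. A (e i) y)) * \<psi>)" by (intro sum_mono column) simp
  also have "\<dots> = (real (n * n) + (\<Sum>i<n. \<Sum>y\<in>D. A (e i) y)) * \<psi>"
    by (simp add: sum_distrib_right[symmetric] sum.distrib)
  also have "(\<Sum>i<n. \<Sum>y\<in>D. A (e i) y) = (\<Sum>x\<in>C. \<Sum>y\<in>D. A x y)"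
    by (rule sum.reindex_bij_betw[OF e])
  finally show ?thesis using \<psi> by simp
qed

text \<open>This supplies, in a span of too many eigenvectors, a nontrivial combination that
  vanishes on one side of the split graph.\<close>

lemma homogeneous_system:
  fixes z :: "'c \<Rightarrow> 'p \<Rightarrow> real"
  assumes "finite P" "finite C" "card C < card P"
  obtains x where "ip P x x \<noteq> 0" "\<And>i. i \<in> C \<Longrightarrow> ip P (z i) x = 0"
proof -
  obtain e where e: "bij_betw e {..<card C} C"
    using ex_bij_betw_nat_finite[OF assms(2)] by (auto simp: atLeast0LessThan)
  obtain k v where kv: "k \<le> card C" "orthonormal P k v"
    "\<And>a p. a < card C \<Longrightarrow> p \<in> P \<Longrightarrow> z (e a) p = (\<Sum>b<k. ip P (v b) (z (e a)) * v b p)"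
    using gram_schmidt_frame[OF assms(1), of "card C" "\<lambda>a. z (e a)"] by blast
  have "k < card P" using kv(1) assms(3) by simp
  from orthonormal_extend[OF assms(1) kv(2) this]
  obtain x where x: "\<And>a. a < k \<Longrightarrow> ip P (v a) x = 0" "ip P x x \<noteq> 0" by blast
  have "ip P (z i) x = 0" if "i \<in> C" for i
  proof -
    have "i \<in> e ` {..<card C}" using that bij_betw_imp_surj_on[OF e] by simp
    then obtain a where a: "a < card C" "i = e a" by blast
    have "ip P (z i) x = ip P (\<lambda>p. \<Sum>b<k. ip P (v b) (z (e a)) * v b p) x"
      unfolding a(2) by (rule ip_cong) (rule kv(3)[OF a(1)], simp_all)
    thus ?thesis by (simp add: ip_linear x(1))
  qed
  thus ?thesis using that x(2) by blast
qed

section \<open>Energies and eigenbases of weighted graph Laplacians\<close>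

lemma energy_eq:
  assumes "\<And>x y. A x y = A y x"
  shows "ip V f (lap V A f) = (\<Sum>x\<in>V. \<Sum>y\<in>V. A x y * (f x - f y)\<^sup>2) / 2"
proof -
  let ?S = "ip V f (lap V A f)"
  have 1: "?S = (\<Sum>x\<in>V. \<Sum>y\<in>V. f x * (A x y * (f x - f y)))"
    by (simp add: ip_def lap_def sum_distrib_left)
  have "?S = (\<Sum>x\<in>V. \<Sum>y\<in>V. f y * (A y x * (f y - f x)))"
    unfolding 1 by (rule sum.swap)
  hence "?S + ?S = (\<Sum>x\<in>V. \<Sum>y\<in>V. f x * (A x y * (f x - f y)) + f y * (A y x * (f y - f x)))"
    using 1 by (simp add: sum.distrib)
  also have "\<dots> = (\<Sum>x\<in>V. \<Sum>y\<in>V. A x y * (f x - f y)\<^sup>2)"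
  proof (intro sum.cong refl)
    fix x y
    show "f x * (A x y * (f x - f y)) + f y * (A y x * (f y - f x)) = A x y * (f x - f y)\<^sup>2"
      unfolding assms[of y x] by (simp add: power2_eq_square algebra_simps)
  qed
  finally show ?thesis by simp
qed

text \<open>The eigenvalue 0 may be multiple, and then an arbitrary eigenbasis need not separate the
  constants. Both the determinant estimate and the passage to the complementary graph need the other
  eigenvectors to have sum zero.\<close>

lemma laplacian_eigenbasis:
  fixes A :: "'v \<Rightarrow> 'v \<Rightarrow> real"
  assumes fin: "finite V" and ne: "V \<noteq> {}" and A_sym: "\<And>x y. A x y = A y x"
    and A_bounds: "\<And>x y. 0 \<le> A x y" "\<And>x y. A x y \<le> 1"
  obtains u l a0 where "orthonormal V (card V) u" "a0 < card V" "l a0 = 0"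
    "\<And>a. a < card V \<Longrightarrow> a \<noteq> a0 \<Longrightarrow> (\<Sum>x\<in>V. u a x) = 0"
    "\<And>a x. a < card V \<Longrightarrow> x \<in> V \<Longrightarrow> lap V A (u a) x = l a * u a x"
proof -
  define n where "n = card V"
  have n: "n > 0" using fin ne by (simp add: n_def card_gt_0_iff)
  \<comment> \<open>Adding 3 everywhere moves the constants to the eigenvalue \<open>3 n\<close>, which exceeds all others (at most
    \<open>2 n\<close>), so that an eigenbasis of \<open>M\<close> must contain a constant function.\<close>
  define M where "M = (\<lambda>x y. (if x = y then \<Sum>z\<in>V. A x z else 0) - A x y + 3)"
  have mv: "mv V M f x = lap V A f x + 3 * (\<Sum>y\<in>V. f y)" if "x \<in> V" for f x
  proof -
    have "mv V M f x = (\<Sum>y\<in>V. (if x = y then (\<Sum>z\<in>V. A x z) * f y else 0) - A x y * f y + 3 * f y)"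
      unfolding mv_def M_def by (intro sum.cong refl) (simp add: algebra_simps)
    also have "\<dots> = (\<Sum>z\<in>V. A x z) * f x - (\<Sum>y\<in>V. A x y * f y) + 3 * (\<Sum>y\<in>V. f y)"
      using fin that by (simp add: sum.distrib sum_subtractf sum_distrib_left)
    finally show ?thesis
      by (simp add: lap_def right_diff_distrib sum_subtractf sum_distrib_right)
  qed
  have "M x y = M y x" for x y using A_sym by (simp add: M_def)
  then obtain u \<nu> where u: "orthonormal V n u"
    "\<And>a x. a < n \<Longrightarrow> x \<in> V \<Longrightarrow> mv V M (u a) x = \<nu> a * u a x"
    using spectral_frame[OF fin, of M] unfolding n_def by metis
  define s where "s = (\<lambda>a. \<Sum>x\<in>V. u a x)"
  have lap_sum: "(\<Sum>x\<in>V. lap V A f x) = 0" for f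
  proof -
    have "(\<Sum>x\<in>V. lap V A f x) = (\<Sum>x\<in>V. \<Sum>y\<in>V. A y x * (f y - f x))"
      unfolding lap_def by (rule sum.swap)
    also have "\<dots> = - (\<Sum>x\<in>V. lap V A f x)"
      unfolding lap_def sum_negf[symmetric]
      by (intro sum.cong refl) (simp add: A_sym algebra_simps)
    finally show ?thesis by simp
  qed
  have eig: "lap V A (u a) x + 3 * s a = \<nu> a * u a x" if "a < n" "x \<in> V" for a x
    using u(2)[OF that] mv[OF that(2)] by (simp add: s_def)
  have s_eig: "s a = 0 \<or> \<nu> a = 3 * real n" if a: "a < n" for a
  proof -
    have "(\<Sum>x\<in>V. lap V A (u a) x + 3 * s a) = (\<Sum>x\<in>V. \<nu> a * u a x)"
      using eig[OF a] by simp
    hence "3 * real n * s a = \<nu> a * s a"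
      by (simp add: sum.distrib lap_sum n_def sum_distrib_left[symmetric] s_def mult.commute)
    thus ?thesis by (auto simp: mult.commute)
  qed
  have ip1: "ip V (u a) (\<lambda>_. 1) = s a" for a by (simp add: ip_def s_def)
  have "ip V (\<lambda>_. 1) (\<lambda>_. 1) = real n" by (simp add: ip_def n_def)
  hence "(\<Sum>a<n. s a * s a) = real n"
    using parseval[OF fin u(1)[unfolded n_def], of "\<lambda>_. 1" "\<lambda>_. 1"] by (simp add: ip1 n_def)
  then obtain a0 where a0: "a0 < n" "s a0 \<noteq> 0" using n by (metis (no_types, lifting) lessThan_iff mult_zero_left of_nat_0_less_iff order_less_irrefl sum.neutral)
  have s0: "s a = 0" if a: "a < n" "a \<noteq> a0" for a
  proof (rule ccontr)
    assume sa: "s a \<noteq> 0"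
    \<comment> \<open>This combination cancels the contributions of the added constant 3, so
      \<open>v\<close> is an eigenvector of \<open>lap\<close> itself for \<open>3 n\<close>, above
      the bound \<open>2 n\<close>.\<close>
    define v where "v = (\<lambda>x. s a0 * u a x - s a * u a0 x)"
    have \<nu>: "\<nu> a = 3 * real n" "\<nu> a0 = 3 * real n" using s_eig a a0 sa by blast+
    have lap_v: "lap V A v x = s a0 * lap V A (u a) x - s a * lap V A (u a0) x" for x
      by (simp add: lap_def v_def sum_distrib_left sum_subtractf[symmetric] algebra_simps)
    have lv: "lap V A v x = 3 * real n * v x" if "x \<in> V" for x
    proof -
      have laps: "lap V A (u a) x = 3 * real n * u a x - 3 * s a"
        "lap V A (u a0) x = 3 * real n * u a0 x - 3 * s a0"
        using eig[OF a(1) that] eig[OF a0(1) that] unfolding \<nu> by linarith+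
      show ?thesis unfolding lap_v laps unfolding v_def by (simp add: algebra_simps)
    qed
    have vv: "ip V v v = (s a0)\<^sup>2 + (s a)\<^sup>2"
      unfolding v_def ip_linear using u(1) a a0 by (simp add: orthonormal_def power2_eq_square)
    have "3 * real n * ip V v v = ip V v (lap V A v)"
      by (simp add: ip_def lv sum_distrib_left ac_simps)
    also have "\<dots> = (\<Sum>x\<in>V. \<Sum>y\<in>V. A x y * (v x - v y)\<^sup>2) / 2" by (rule energy_eq[OF A_sym])
    also have "\<dots> \<le> (\<Sum>x\<in>V. \<Sum>y\<in>V. 2 * (v x)\<^sup>2 + 2 * (v y)\<^sup>2) / 2"
    proof (intro divide_right_mono sum_mono)
      fix x y
      have "A x y * (v x - v y)\<^sup>2 \<le> 1 * (v x - v y)\<^sup>2" by (intro mult_right_mono A_bounds) simp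
      also have "\<dots> \<le> 2 * (v x)\<^sup>2 + 2 * (v y)\<^sup>2"
        using zero_le_power2[of "v x + v y"] by (simp add: power2_eq_square algebra_simps)
      finally show "A x y * (v x - v y)\<^sup>2 \<le> 2 * (v x)\<^sup>2 + 2 * (v y)\<^sup>2" .
    qed simp
    also have "\<dots> = 2 * real n * ip V v v"
      by (simp add: sum.distrib ip_def n_def sum_distrib_left[symmetric] power2_eq_square)
    finally have "real n * ip V v v \<le> 0" by (simp add: algebra_simps)
    moreover have "real n * ip V v v > 0" using n vv a0 by (simp add: add_pos_nonneg)
    ultimately show False by simp
  qed
  \<comment> \<open>On constants the value \<open>3 n\<close> comes from the shifted matrix, while
    \<open>lap\<close> gives 0. The other eigenvectors have sum zero, so the shift leaves their
    eigenvalues unchanged.\<close>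
  define l where "l = (\<lambda>a. if a = a0 then 0 else \<nu> a)"
  have const: "u a0 x = 1 / s a0" if x: "x \<in> V" for x
  proof -
    have "1 = (\<Sum>a<n. s a * u a x)"
      using orthonormal_expand[OF fin u(1)[unfolded n_def] x, of "\<lambda>_. 1"] by (simp add: ip1 n_def)
    also have "\<dots> = (\<Sum>a<n. if a = a0 then s a0 * u a0 x else 0)"
      by (rule sum.cong) (use s0 in auto)
    also have "\<dots> = s a0 * u a0 x" using a0 by simp
    finally show ?thesis using a0 by (simp add: field_simps)
  qed
  have "lap V A (u a) x = l a * u a x" if "a < n" "x \<in> V" for a x
  proof (cases "a = a0")
    case True
    thus ?thesis using const that by (simp add: lap_def l_def)
  next
    case False
    thus ?thesis using eig[OF that] s0[OF that(1)] by (simp add: l_def)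
  qed
  thus ?thesis
    using that[of u a0 l] u(1) a0(1) s0 by (simp add: n_def s_def l_def)
qed


lemma lap_add: "lap V A (\<lambda>x. f x + g x) = (\<lambda>x. lap V A f x + lap V A g x)"
  by (simp add: lap_def fun_eq_iff sum.distrib[symmetric] algebra_simps)

lemma lap_scale: "lap V A (\<lambda>x. c * f x) = (\<lambda>x. c * lap V A f x)"
  by (simp add: lap_def fun_eq_iff sum_distrib_left algebra_simps)

lemma lap_sum: "lap V A (\<lambda>x. \<Sum>a\<in>I. f a x) = (\<lambda>x. \<Sum>a\<in>I. lap V A (f a) x)"
  by (induction I rule: infinite_finite_induct) (simp_all add: lap_def[of _ _ "\<lambda>_. 0"] lap_add)

lemma lap_cong: "x \<in> V \<Longrightarrow> (\<And>y. y \<in> V \<Longrightarrow> f y = g y) \<Longrightarrow> lap V A f x = lap V A g x"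
  by (simp add: lap_def)

lemma eigen_combination:
  fixes x :: "nat \<Rightarrow> real"
  assumes "orthonormal V n u" "P \<subseteq> {..<n}"
    and eig: "\<And>a x. a < n \<Longrightarrow> x \<in> V \<Longrightarrow> lap V A (u a) x = l a * u a x"
  defines "g \<equiv> \<lambda>y. \<Sum>b\<in>P. x b * u b y"
  shows "ip V g g = (\<Sum>b\<in>P. (x b)\<^sup>2)"
    and "ip V g (lap V A g) = (\<Sum>b\<in>P. l b * (x b)\<^sup>2)"
proof -
  have P: "finite P" using assms(2) finite_subset by blast
  have ug: "ip V (u b) g = x b" if b: "b \<in> P" for b
  proof -
    have "ip V (u b) g = (\<Sum>a\<in>P. if a = b then x a else 0)"
      unfolding g_def ip_sum_right ip_scale_right
      by (rule sum.cong) (use assms(1,2) b in \<open>auto simp: orthonormal_def subset_iff\<close>)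
    thus ?thesis using P b by simp
  qed
  have "ip V g g = (\<Sum>b\<in>P. x b * ip V (u b) g)" by (subst (1) g_def) (simp only: ip_linear)
  thus "ip V g g = (\<Sum>b\<in>P. (x b)\<^sup>2)" by (simp add: ug power2_eq_square)
  have "ip V g (lap V A g) = ip V g (\<lambda>y. \<Sum>b\<in>P. x b * (l b * u b y))"
  proof (rule ip_cong)
    fix y assume y: "y \<in> V"
    have "lap V A g y = (\<Sum>b\<in>P. x b * lap V A (u b) y)" unfolding g_def lap_sum lap_scale ..
    also have "\<dots> = (\<Sum>b\<in>P. x b * (l b * u b y))"
      by (rule sum.cong) (use eig y assms(2) in auto)
    finally show "lap V A g y = (\<Sum>b\<in>P. x b * (l b * u b y))" .
  qed simp
  also have "\<dots> = (\<Sum>b\<in>P. x b * (l b * ip V (u b) g))"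
    by (simp only: ip_linear ip_commute[of V g])
  finally show "ip V g (lap V A g) = (\<Sum>b\<in>P. l b * (x b)\<^sup>2)"
    by (simp add: ug power2_eq_square ac_simps)
qed

section \<open>Frame energies on split graphs and on arbitrary graphs\<close>

lemma orthonormal_reindex:
  assumes "orthonormal V n u" "inj_on h {..<k}" "h ` {..<k} \<subseteq> {..<n}"
  shows "orthonormal V k (\<lambda>a. u (h a))"
  using assms by (auto simp: orthonormal_def inj_on_def image_subset_iff)

text \<open>Expanding in an eigenbasis removes the frame from the problem: what remains is that the
  total excess of the eigenvalues over \<open>card C\<close> is at most the weight between
  \<open>C\<close> and \<open>D\<close>. The determinant estimate works for exactly
  \<open>card C\<close> eigenvectors, hence the case distinction.\<close>

lemma split_graph_energy:
  fixes w :: "nat \<Rightarrow> 'v \<Rightarrow> real"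
  assumes fin: "finite C" "finite D" and dis: "C \<inter> D = {}"
    and A_sym: "\<And>x y. A x y = A y x"
    and A_bounds: "\<And>x y. 0 \<le> A x y" "\<And>x y. A x y \<le> 1"
    and A_C: "\<And>x y. x \<in> C \<Longrightarrow> y \<in> C \<Longrightarrow> A x y = 1"
    and A_D: "\<And>x y. x \<in> D \<Longrightarrow> y \<in> D \<Longrightarrow> A x y = 0"
    and w: "orthonormal (C \<union> D) t w"
  shows "(\<Sum>k<t. ip (C \<union> D) (w k) (lap (C \<union> D) A (w k)))
    \<le> real t * real (card C) + (\<Sum>x\<in>C. \<Sum>y\<in>D. A x y)"
proof (cases "C \<union> D = {}")
  case True
  thus ?thesis by (simp add: ip_def)
next
  case False
  define V where "V = C \<union> D"
  have finV: "finite V" and V: "V \<noteq> {}" using fin False by (auto simp: V_def)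
  define n c m where "n = card V" and "c = card C" and "m = card D"
  have ncm: "n = c + m" using fin dis by (simp add: n_def V_def c_def m_def card_Un_disjoint)
  define E where "E = (\<Sum>x\<in>C. \<Sum>y\<in>D. A x y)"
  have split: "(\<Sum>y\<in>V. h y) = (\<Sum>y\<in>C. h y) + (\<Sum>y\<in>D. h y)" for h :: "'v \<Rightarrow> real"
    unfolding V_def using fin dis by (rule sum.union_disjoint)
  obtain u l a0 where u: "orthonormal V n u" and a0: "a0 < n" "l a0 = 0"
    and sum0: "\<And>a. a < n \<Longrightarrow> a \<noteq> a0 \<Longrightarrow> (\<Sum>x\<in>V. u a x) = 0"
    and eig: "\<And>a x. a < n \<Longrightarrow> x \<in> V \<Longrightarrow> lap V A (u a) x = l a * u a x"
    by (rule laplacian_eigenbasis[of V A, OF finV V A_sym A_bounds, folded n_def]) blast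
  define P where "P = {a. a < n \<and> real c < l a}"
  have P: "finite P" "P \<subseteq> {..<n}" "a0 \<notin> P" using a0 by (auto simp: P_def)
  have reduce: "(\<Sum>k<t. ip V (w k) (lap V A (w k))) \<le> real t * real c + (\<Sum>a\<in>P. l a - real c)"
  proof -
    \<comment> \<open>The weights \<open>p a\<close> lie between 0 and 1 and add up to
      \<open>t\<close>, so the weighted excess over \<open>c\<close> is at most the sum of its
      positive parts, which is taken over \<open>P\<close>.\<close>
    define p where "p = (\<lambda>a. \<Sum>k<t. (ip V (u a) (w k))\<^sup>2)"
    have p0: "p a \<ge> 0" for a by (simp add: p_def sum_nonneg)
    have p1: "p a \<le> 1" if "a < n" for a
    proof -
      have "p a = (\<Sum>k<t. (ip V (w k) (u a))\<^sup>2)" by (simp add: p_def ip_commute[of V "u a"])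
      also have "\<dots> \<le> ip V (u a) (u a)" using w unfolding V_def by (rule bessel)
      finally have "p a \<le> ip V (u a) (u a)" .
      thus ?thesis using u that by (simp add: orthonormal_def)
    qed
    have energy: "ip V (w k) (lap V A (w k)) = (\<Sum>a<n. l a * (ip V (u a) (w k))\<^sup>2)" for k
    proof -
      define g where "g = (\<lambda>y. \<Sum>a<n. ip V (u a) (w k) * u a y)"
      have wg: "w k y = g y" if "y \<in> V" for y
        unfolding g_def n_def by (rule orthonormal_expand[OF finV u[unfolded n_def] that])
      have "ip V (w k) (lap V A (w k)) = ip V g (lap V A g)"
        by (rule ip_cong) (auto simp: wg intro: lap_cong)
      also have "\<dots> = (\<Sum>a<n. l a * (ip V (u a) (w k))\<^sup>2)"
        unfolding g_def by (rule eigen_combination(2)[OF u _ eig]) auto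
      finally show ?thesis .
    qed
    have norm: "(\<Sum>a<n. p a) = real t"
    proof -
      have "(\<Sum>a<n. p a) = (\<Sum>k<t. \<Sum>a<n. ip V (u a) (w k) * ip V (u a) (w k))"
        unfolding p_def power2_eq_square by (rule sum.swap)
      also have "\<dots> = (\<Sum>k<t. ip V (w k) (w k))"
        by (intro sum.cong refl parseval[OF finV u[unfolded n_def], folded n_def, symmetric])
      also have "\<dots> = real t" using w by (simp add: V_def orthonormal_def)
      finally show ?thesis .
    qed
    have "(\<Sum>k<t. ip V (w k) (lap V A (w k))) = (\<Sum>a<n. l a * p a)"
      unfolding energy p_def sum_distrib_left by (rule sum.swap)
    also have "\<dots> = real t * real c + (\<Sum>a<n. (l a - real c) * p a)"
      unfolding norm[symmetric] by (simp add: left_diff_distrib sum_subtractf sum_distrib_left[symmetric])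
    also have "(\<Sum>a<n. (l a - real c) * p a) \<le> (\<Sum>a<n. if a \<in> P then l a - real c else 0)"
    proof (rule sum_mono)
      fix a assume a: "a \<in> {..<n}"
      show "(l a - real c) * p a \<le> (if a \<in> P then l a - real c else 0)"
      proof (cases "a \<in> P")
        case True
        hence "(l a - real c) * p a \<le> (l a - real c) * 1"
          using p1 a by (intro mult_left_mono) (auto simp: P_def)
        thus ?thesis using True by simp
      next
        case False
        hence "l a \<le> real c" using a by (simp add: P_def not_less)
        thus ?thesis using False p0[of a] by (simp add: mult_nonpos_nonneg)
      qed
    qed
    also have "\<dots> = (\<Sum>a\<in>P. l a - real c)"
      using P(2) by (simp add: sum.inter_restrict[symmetric] Int_absorb1 flip: sum.inter_restrict)
    finally show ?thesis by simp
  qed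

  have A_row: "(\<Sum>y\<in>C. A x y) \<le> real c" for x
    using sum_bounded_above[of C "A x" 1] A_bounds by (simp add: c_def)
  \<comment> \<open>With more than \<open>c\<close> such eigenvalues some combination vanishes on
    \<open>C\<close>. Since \<open>D\<close> is independent and each of its vertices has total
    weight at most \<open>c\<close> to \<open>C\<close>, the energy is at most \<open>c\<close>
    times the squared norm, a contradiction.\<close>
  have cardP: "card P \<le> c"
  proof (rule ccontr)
    assume "\<not> card P \<le> c"
    then obtain x where x: "ip P x x \<noteq> 0" "\<And>i. i \<in> C \<Longrightarrow> ip P (\<lambda>b. u b i) x = 0"
      using homogeneous_system[OF P(1) fin(1), of "\<lambda>i b. u b i"] by (auto simp: c_def)
    define g where "g = (\<lambda>y. \<Sum>b\<in>P. x b * u b y)"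
    have gC: "g i = 0" if "i \<in> C" for i using x(2)[OF that] by (simp add: g_def ip_def mult.commute)
    have comb: "ip V g g = (\<Sum>b\<in>P. (x b)\<^sup>2)" "ip V g (lap V A g) = (\<Sum>b\<in>P. l b * (x b)\<^sup>2)"
      unfolding g_def by (rule eigen_combination[OF u P(2)]; use eig in blast)+
    have "(\<Sum>b\<in>P. (l b - real c) * (x b)\<^sup>2) > 0"
    proof -
      obtain b where b: "b \<in> P" "x b \<noteq> 0" using x(1) P(1) by (auto simp: ip_self_eq_0)
      show ?thesis
        by (rule sum_pos2[OF P(1) b(1)]) (use b in \<open>auto simp: P_def\<close>)
    qed
    hence "real c * ip V g g < ip V g (lap V A g)"
      unfolding comb by (simp add: left_diff_distrib sum_subtractf sum_distrib_left)
    also have "ip V g (lap V A g) = (\<Sum>y\<in>D. g y * lap V A g y)"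
      unfolding ip_def split by (simp add: gC)
    also have "\<dots> \<le> (\<Sum>y\<in>D. real c * (g y)\<^sup>2)"
    proof (rule sum_mono)
      fix y assume y: "y \<in> D"
      have "lap V A g y = (\<Sum>z\<in>C. A y z) * g y"
        unfolding lap_def split by (simp add: gC A_D y sum_distrib_right)
      hence "g y * lap V A g y = (\<Sum>z\<in>C. A y z) * (g y)\<^sup>2" by (simp add: power2_eq_square)
      also have "\<dots> \<le> real c * (g y)\<^sup>2" by (intro mult_right_mono A_row) simp
      finally show "g y * lap V A g y \<le> real c * (g y)\<^sup>2" .
    qed
    also have "\<dots> = real c * ip V g g"
      unfolding ip_def split by (simp add: gC sum_distrib_left power2_eq_square)
    finally show False by simp
  qed

  define N where "N = {a. a < n \<and> a \<noteq> a0 \<and> l a < real c}"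
  have N: "finite N" "N \<subseteq> {..<n}" by (auto simp: N_def)
  \<comment> \<open>The mirror image: a combination that vanishes on \<open>D\<close> and has sum
    zero gets at least \<open>c\<close> times its squared norm from the clique alone. Leaving out
    \<open>a0\<close> makes the sum zero.\<close>
  have cardN: "card N \<le> m"
  proof (rule ccontr)
    assume "\<not> card N \<le> m"
    then obtain x where x: "ip N x x \<noteq> 0" "\<And>i. i \<in> D \<Longrightarrow> ip N (\<lambda>b. u b i) x = 0"
      using homogeneous_system[OF N(1) fin(2), of "\<lambda>i b. u b i"] by (auto simp: m_def)
    define g where "g = (\<lambda>y. \<Sum>b\<in>N. x b * u b y)"
    have gD: "g i = 0" if "i \<in> D" for i using x(2)[OF that] by (simp add: g_def ip_def mult.commute)
    have comb: "ip V g g = (\<Sum>b\<in>N. (x b)\<^sup>2)" "ip V g (lap V A g) = (\<Sum>b\<in>N. l b * (x b)\<^sup>2)"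
      unfolding g_def by (rule eigen_combination[OF u N(2)]; use eig in blast)+
    have "(\<Sum>y\<in>V. g y) = (\<Sum>b\<in>N. x b * (\<Sum>y\<in>V. u b y))"
      unfolding g_def sum_distrib_left by (rule sum.swap)
    also have "\<dots> = 0" using sum0 by (simp add: N_def)
    finally have gsum: "(\<Sum>y\<in>C. g y) = 0" unfolding split by (simp add: gD)
    have "(\<Sum>b\<in>N. (real c - l b) * (x b)\<^sup>2) > 0"
    proof -
      obtain b where b: "b \<in> N" "x b \<noteq> 0" using x(1) N(1) by (auto simp: ip_self_eq_0)
      show ?thesis
        by (rule sum_pos2[OF N(1) b(1)]) (use b in \<open>auto simp: N_def\<close>)
    qed
    hence "ip V g (lap V A g) < real c * ip V g g"
      unfolding comb by (simp add: left_diff_distrib sum_subtractf sum_distrib_left)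
    also have "real c * ip V g g = (\<Sum>y\<in>C. real c * (g y)\<^sup>2)"
      unfolding ip_def split by (simp add: gD sum_distrib_left power2_eq_square)
    also have "\<dots> \<le> (\<Sum>y\<in>C. g y * lap V A g y)"
    proof (rule sum_mono)
      fix y assume y: "y \<in> C"
      have "lap V A g y = (\<Sum>z\<in>C. g y - g z) + (\<Sum>z\<in>D. A y z) * g y"
        unfolding lap_def split by (simp add: gD A_C y sum_distrib_right)
      also have "(\<Sum>z\<in>C. g y - g z) = real c * g y" by (simp add: sum_subtractf gsum c_def)
      finally have "g y * lap V A g y = real c * (g y)\<^sup>2 + (\<Sum>z\<in>D. A y z) * (g y)\<^sup>2"
        by (simp add: power2_eq_square algebra_simps)
      thus "real c * (g y)\<^sup>2 \<le> g y * lap V A g y" by (simp add: sum_nonneg A_bounds)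
    qed
    also have "\<dots> = ip V g (lap V A g)" unfolding ip_def split by (simp add: gD)
    finally show False by simp
  qed

  have "(\<Sum>a\<in>P. l a - real c) \<le> E"
  proof (cases "card P = c")
    case True
    have "D \<noteq> {}"
    proof
      assume "D = {}"
      hence "card P = card {..<n}" using True by (simp add: ncm m_def)
      hence "P = {..<n}" using P by (intro card_subset_eq) auto
      thus False using a0 P by auto
    qed
    obtain h where "bij_betw h {0..<card P} P" using ex_bij_betw_nat_finite[OF P(1)] by blast
    hence h: "bij_betw h {..<c} P" using True by (simp add: atLeast0LessThan)
    hence hP: "h a \<in> P" if "a < c" for a using that by (auto simp: bij_betw_def)
    have "(\<Sum>a<c. l (h a)) \<le> real (c * c) + (\<Sum>x\<in>C. \<Sum>y\<in>D. A x y)"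
    proof (rule split_graph_eigensum[OF fin dis \<open>D \<noteq> {}\<close> A_sym A_bounds A_C A_D c_def, folded V_def])
      show "orthonormal V c (\<lambda>a. u (h a))"
        by (rule orthonormal_reindex[OF u]) (use h P in \<open>auto simp: bij_betw_def\<close>)
      show "(\<Sum>v\<in>V. u (h a) v) = 0" if "a < c" for a
        using sum0[of "h a"] hP[OF that] P by auto
      show "lap V A (u (h a)) v = l (h a) * u (h a) v" if "a < c" "v \<in> V" for a v
        using eig hP[OF that(1)] P that by auto
    qed
    also have "(\<Sum>a<c. l (h a)) = (\<Sum>a\<in>P. l a)" by (rule sum.reindex_bij_betw[OF h])
    finally show ?thesis using True by (simp add: sum_subtractf E_def)
  next
    case False
    hence Pc: "card P < c" using cardP by simp
    hence "C \<noteq> {}" by (auto simp: c_def)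
    define R where "R = {..<n} - {a0}"
    have R: "finite R" "card R = n - 1" "R \<subseteq> {..<n}" using a0 by (auto simp: R_def)
    have PRN: "P \<subseteq> R - N" using P by (auto simp: R_def N_def P_def)
    have "c - 1 \<le> card (R - N)"
      using diff_card_le_card_Diff[OF N(1), of R] cardN R(2) ncm by linarith
    moreover have "card P \<le> c - 1" using Pc by simp
    \<comment> \<open>The added eigenvalues equal \<open>c\<close>, so padding does not change the
      excess. The size \<open>c - 1\<close> leaves exactly \<open>m = card D\<close> eigenvectors
      besides \<open>u a0\<close>, the number that the determinant estimate demands for the
      complementary graph.\<close>
    ultimately obtain Q where Q: "P \<subseteq> Q" "Q \<subseteq> R - N" "card Q = c - 1"
      using exists_subset_between[of P "c - 1" "R - N"] PRN finite_Diff[OF R(1)] by blast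
    have finQ: "finite Q" using Q(2) R(1) finite_subset by blast
    have QR: "Q \<subseteq> R" using Q(2) by blast
    define Q' where "Q' = R - Q"
    have Q': "finite Q'" "Q' \<subseteq> R" "card Q' = m"
      using R finQ QR Q(3) ncm Pc by (auto simp: Q'_def card_Diff_subset)
    obtain h where "bij_betw h {0..<card Q'} Q'" using ex_bij_betw_nat_finite[OF Q'(1)] by blast
    hence h: "bij_betw h {..<m} Q'" using Q'(3) by (simp add: atLeast0LessThan)
    hence hQ: "h a \<in> R" if "a < m" for a using that Q'(2) by (auto simp: bij_betw_def)
    have hn: "h a < n" "h a \<noteq> a0" if "a < m" for a using hQ[OF that] by (auto simp: R_def)
    \<comment> \<open>The weight \<open>1 - A\<close> exchanges clique and independent set. On
      functions of sum zero the Laplacian of the all-ones weight is \<open>n\<close>, so each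
      eigenvalue \<open>l\<close> becomes \<open>n - l\<close>.\<close>
    have "(\<Sum>a<m. real n - l (h a)) \<le> real (m * m) + (\<Sum>x\<in>D. \<Sum>y\<in>C. 1 - A x y)"
    proof (rule split_graph_eigensum[of D C "\<lambda>x y. 1 - A x y" m "\<lambda>a. u (h a)", unfolded Un_commute[of D C], folded V_def])
      show "orthonormal V m (\<lambda>a. u (h a))"
        by (rule orthonormal_reindex[OF u]) (use h hn in \<open>auto simp: bij_betw_def\<close>)
      show "(\<Sum>v\<in>V. u (h a) v) = 0" if "a < m" for a
        using sum0 hn that by blast
      show "lap V (\<lambda>x y. 1 - A x y) (u (h a)) v = (real n - l (h a)) * u (h a) v"
        if a: "a < m" and v: "v \<in> V" for a v
      proof -
        have "lap V (\<lambda>x y. 1 - A x y) (u (h a)) v = (\<Sum>y\<in>V. u (h a) v - u (h a) y) - lap V A (u (h a)) v"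
          by (simp add: lap_def left_diff_distrib sum_subtractf)
        also have "(\<Sum>y\<in>V. u (h a) v - u (h a) y) = real n * u (h a) v"
          using sum0[OF hn[OF a]] by (simp add: sum_subtractf n_def)
        finally show ?thesis using eig[OF hn(1)[OF a] v] by (simp add: left_diff_distrib)
      qed
    qed (use fin dis \<open>C \<noteq> {}\<close> A_sym A_bounds A_C A_D in \<open>auto simp: m_def\<close>)
    also have "(\<Sum>x\<in>D. \<Sum>y\<in>C. 1 - A x y) = real m * real c - E"
    proof -
      have "E = (\<Sum>x\<in>D. \<Sum>y\<in>C. A x y)" unfolding E_def by (subst sum.swap) (simp add: A_sym)
      thus ?thesis by (simp add: sum_subtractf m_def c_def)
    qed
    also have "(\<Sum>a<m. real n - l (h a)) = (\<Sum>a\<in>Q'. real n - l a)"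
      by (rule sum.reindex_bij_betw[OF h])
    finally have "E \<le> (\<Sum>a\<in>Q'. l a)"
      by (simp add: sum_subtractf Q'(3) ncm algebra_simps)
    \<comment> \<open>The complement bounds the eigenvalues outside \<open>Q\<close> from below by
      \<open>E\<close>; subtracting from the trace bounds those in \<open>Q\<close> from
      above.\<close>
    moreover have trace: "(\<Sum>a<n. l a) = real c * (real c - 1) + 2 * E"
    proof -
      have lx: "(\<Sum>a<n. l a * (u a x)\<^sup>2) = (\<Sum>y\<in>V. A x y) - A x x" if x: "x \<in> V" for x
      proof -
        have "(\<Sum>a<n. l a * (u a x)\<^sup>2) = (\<Sum>a<n. lap V A (u a) x * u a x)"
          by (rule sum.cong) (use eig x in \<open>auto simp: power2_eq_square\<close>)
        also have "\<dots> = (\<Sum>y\<in>V. A x y * (\<Sum>a<n. u a x * u a x) - A x y * (\<Sum>a<n. u a x * u a y))"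
          unfolding lap_def sum_distrib_right
          by (subst sum.swap) (simp add: sum_distrib_left sum_subtractf[symmetric] algebra_simps)
        also have "\<dots> = (\<Sum>y\<in>V. A x y - (if x = y then A x y else 0))"
          by (rule sum.cong) (use orthonormal_complete[OF finV u[unfolded n_def] x] x in \<open>auto simp: n_def\<close>)
        finally show ?thesis using finV x by (simp add: sum_subtractf)
      qed
      have "(\<Sum>a<n. l a) = (\<Sum>a<n. l a * ip V (u a) (u a))" using u by (simp add: orthonormal_def)
      also have "\<dots> = (\<Sum>x\<in>V. \<Sum>a<n. l a * (u a x)\<^sup>2)"
        unfolding ip_def sum_distrib_left power2_eq_square by (rule sum.swap)
      also have "\<dots> = (\<Sum>x\<in>V. (\<Sum>y\<in>V. A x y) - A x x)" by (rule sum.cong) (auto simp: lx)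
      also have "\<dots> = (\<Sum>x\<in>C. real c - 1 + (\<Sum>y\<in>D. A x y)) + (\<Sum>x\<in>D. \<Sum>y\<in>C. A x y)"
        unfolding split by (simp add: A_C A_D c_def algebra_simps)
      also have "(\<Sum>x\<in>D. \<Sum>y\<in>C. A x y) = E" unfolding E_def by (subst sum.swap) (simp add: A_sym)
      finally show ?thesis by (simp add: sum.distrib E_def[symmetric] c_def)
    qed
    moreover have "(\<Sum>a<n. l a) = (\<Sum>a\<in>Q. l a) + (\<Sum>a\<in>Q'. l a)"
    proof -
      have "(\<Sum>a<n. l a) = l a0 + (\<Sum>a\<in>R. l a)"
        using a0 by (simp add: R_def sum.remove[of _ a0])
      thus ?thesis using a0 sum.subset_diff[OF QR R(1), of l] by (simp add: Q'_def)
    qed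
    ultimately have "(\<Sum>a\<in>Q. l a) \<le> real c * (real c - 1) + E" by linarith
    hence "(\<Sum>a\<in>Q. l a - real c) \<le> E"
      using Pc by (simp add: sum_subtractf Q(3) of_nat_diff algebra_simps)
    moreover have "(\<Sum>a\<in>P. l a - real c) \<le> (\<Sum>a\<in>Q. l a - real c)"
      by (rule sum_mono2[OF finQ Q(1)]) (use Q(2) in \<open>auto simp: R_def N_def subset_iff\<close>)
    ultimately show ?thesis by linarith
  qed
  thus ?thesis using reduce by (simp add: V_def E_def c_def)
qed

text \<open>Joining two vertices of \<open>C\<close> cannot decrease the left side and leaves the
  right side alone, where their terms are already \<open>t\<close>. Deleting an edge inside
  \<open>D\<close> lowers the right side by twice its weight and the left side by at most as
  much.\<close>

theorem grone_merris:
  fixes w :: "nat \<Rightarrow> 'v \<Rightarrow> real"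
  assumes fin: "finite V" and A_sym: "\<And>x y. A x y = A y x"
    and A_bounds: "\<And>x y. 0 \<le> A x y" "\<And>x y. A x y \<le> 1"
    and A_diag: "\<And>x. A x x = 0"
    and w: "orthonormal V t w"
  shows "(\<Sum>k<t. ip V (w k) (lap V A (w k))) \<le> (\<Sum>x\<in>V. min (\<Sum>y\<in>V. A x y) (real t))"
proof -
  define C where "C = {x\<in>V. real t \<le> (\<Sum>y\<in>V. A x y)}"
  define D where "D = V - C"
  have CD: "finite C" "finite D" "C \<inter> D = {}" "V = C \<union> D" using fin by (auto simp: C_def D_def)
  have split: "(\<Sum>y\<in>V. h y) = (\<Sum>y\<in>C. h y) + (\<Sum>y\<in>D. h y)" for h :: "'v \<Rightarrow> real"
    unfolding CD(4) using CD by (intro sum.union_disjoint)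
  define A' where "A' = (\<lambda>x y. if x \<in> C \<and> y \<in> C then 1 else if x \<in> D \<and> y \<in> D then 0 else A x y)"
  define q where "q = (\<lambda>x y. \<Sum>k<t. (w k x - w k y)\<^sup>2)"
  have q0: "0 \<le> q x y" for x y by (simp add: q_def sum_nonneg)
  \<comment> \<open>Bessel's inequality for the difference of two point indicators, which has
    squared norm 2.\<close>
  have q2: "q x y \<le> 2" if xy: "x \<in> V" "y \<in> V" for x y
  proof (cases "x = y")
    case False
    let ?d = "\<lambda>z. (if z = x then 1 else 0) - (if z = y then 1 else (0::real))"
    have "ip V h ?d = h x - h y" for h
      unfolding ip_diff_right by (simp add: ip_indicator fin xy)
    from this[of ?d] this have "ip V ?d ?d = 2" "\<And>k. ip V (w k) ?d = w k x - w k y"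
      using False by auto
    thus ?thesis using bessel[OF w, of ?d] by (simp add: q_def)
  qed (simp add: q_def)
  have energy: "(\<Sum>k<t. ip V (w k) (lap V B (w k))) = (\<Sum>x\<in>V. \<Sum>y\<in>V. B x y * q x y) / 2"
    if "\<And>x y. B x y = B y x" for B
  proof -
    have "(\<Sum>k<t. ip V (w k) (lap V B (w k))) = (\<Sum>k<t. \<Sum>x\<in>V. \<Sum>y\<in>V. B x y * (w k x - w k y)\<^sup>2) / 2"
      by (simp add: energy_eq[OF that] sum_divide_distrib)
    also have "(\<Sum>k<t. \<Sum>x\<in>V. \<Sum>y\<in>V. B x y * (w k x - w k y)\<^sup>2) =
        (\<Sum>x\<in>V. \<Sum>k<t. \<Sum>y\<in>V. B x y * (w k x - w k y)\<^sup>2)" by (rule sum.swap)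
    also have "\<dots> = (\<Sum>x\<in>V. \<Sum>y\<in>V. B x y * q x y)"
      unfolding q_def sum_distrib_left by (intro sum.cong refl sum.swap)
    finally show ?thesis .
  qed
  have A'_sym: "\<And>x y. A' x y = A' y x" using A_sym by (auto simp: A'_def)
  have "(\<Sum>x\<in>V. \<Sum>y\<in>V. A x y * q x y) \<le>
      (\<Sum>x\<in>V. \<Sum>y\<in>V. A' x y * q x y + (if x \<in> D \<and> y \<in> D then 2 * A x y else 0))"
  proof (intro sum_mono)
    fix x y assume xy: "x \<in> V" "y \<in> V"
    have "A x y * q x y \<le> 1 * q x y" "A x y * q x y \<le> A x y * 2"
      using q0 q2[OF xy] A_bounds by (intro mult_right_mono mult_left_mono; simp)+
    thus "A x y * q x y \<le> A' x y * q x y + (if x \<in> D \<and> y \<in> D then 2 * A x y else 0)"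
      using CD(3) by (auto simp: A'_def)
  qed
  also have "\<dots> = (\<Sum>x\<in>V. \<Sum>y\<in>V. A' x y * q x y) + 2 * (\<Sum>x\<in>D. \<Sum>y\<in>D. A x y)"
  proof -
    have "(\<Sum>y\<in>V. if x \<in> D \<and> y \<in> D then 2 * A x y else 0) = (if x \<in> D then 2 * (\<Sum>y\<in>D. A x y) else 0)" for x
      unfolding split using CD(3) by (auto simp: sum_distrib_left intro!: sum.neutral)
    hence "(\<Sum>x\<in>V. \<Sum>y\<in>V. if x \<in> D \<and> y \<in> D then 2 * A x y else 0) =
        (\<Sum>x\<in>V. if x \<in> D then 2 * (\<Sum>y\<in>D. A x y) else 0)"
      by (simp only:)
    also have "\<dots> = (\<Sum>x\<in>D. 2 * (\<Sum>y\<in>D. A x y))"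
      unfolding split[of "\<lambda>x. if x \<in> D then _ x else 0"] using CD(3) by (auto intro!: sum.neutral)
    finally have "(\<Sum>x\<in>V. \<Sum>y\<in>V. if x \<in> D \<and> y \<in> D then 2 * A x y else 0) =
        (\<Sum>x\<in>D. 2 * (\<Sum>y\<in>D. A x y))" .
    thus ?thesis by (simp add: sum.distrib sum_distrib_left)
  qed
  finally have "(\<Sum>k<t. ip V (w k) (lap V A (w k))) \<le>
      (\<Sum>k<t. ip V (w k) (lap V A' (w k))) + (\<Sum>x\<in>D. \<Sum>y\<in>D. A x y)"
    unfolding energy[OF A_sym] energy[OF A'_sym] by simp
  also have "(\<Sum>k<t. ip V (w k) (lap V A' (w k))) \<le> real t * real (card C) + (\<Sum>x\<in>C. \<Sum>y\<in>D. A' x y)"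
    unfolding CD(4)
    by (rule split_graph_energy[OF CD(1-3) A'_sym])
      (use A_bounds CD(3) w[unfolded CD(4)] in \<open>auto simp: A'_def\<close>)
  also have "(\<Sum>x\<in>C. \<Sum>y\<in>D. A' x y) = (\<Sum>x\<in>D. \<Sum>y\<in>C. A x y)"
  proof -
    have "(\<Sum>x\<in>C. \<Sum>y\<in>D. A' x y) = (\<Sum>x\<in>C. \<Sum>y\<in>D. A y x)"
      by (intro sum.cong refl) (use CD(3) A_sym in \<open>auto simp: A'_def\<close>)
    also have "\<dots> = (\<Sum>x\<in>D. \<Sum>y\<in>C. A x y)" by (rule sum.swap)
    finally show ?thesis .
  qed
  also have "real t * real (card C) + (\<Sum>x\<in>D. \<Sum>y\<in>C. A x y) + (\<Sum>x\<in>D. \<Sum>y\<in>D. A x y) =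
      (\<Sum>x\<in>C. real t) + (\<Sum>x\<in>D. \<Sum>y\<in>V. A x y)"
    by (simp add: split[symmetric] sum.distrib[symmetric])
  also have "\<dots> = (\<Sum>x\<in>V. min (\<Sum>y\<in>V. A x y) (real t))"
    unfolding split[of "\<lambda>x. min (\<Sum>y\<in>V. A x y) (real t)"]
    by (intro arg_cong2[where f = "(+)"] sum.cong) (auto simp: C_def D_def)
  finally show ?thesis by simp
qed

section \<open>Induction over links\<close>

text \<open>Only the top faces and the ridges of a complex are kept. \<open>X\<close> may also
  contain sets that lie in no member, such as ridges of degree 0.\<close>

definition uniform_family :: "nat \<Rightarrow> 'a set set \<Rightarrow> 'a set set \<Rightarrow> bool" where
  "uniform_family r \<F> X \<longleftrightarrow> finite \<F> \<and> finite X \<and> (\<forall>F\<in>\<F>. finite F \<and> card F = Suc r) \<and>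
     (\<forall>\<sigma>\<in>X. finite \<sigma> \<and> card \<sigma> = r) \<and> (\<forall>F\<in>\<F>. \<forall>v\<in>F. F - {v} \<in> X)"

definition deg :: "'a set set \<Rightarrow> 'a set \<Rightarrow> nat" where
  "deg \<F> S = card {F\<in>\<F>. S \<subseteq> F}"

definition lk :: "'a \<Rightarrow> 'a set set \<Rightarrow> 'a set set" where
  "lk v \<F> = (\<lambda>F. F - {v}) ` {F\<in>\<F>. v \<in> F}"

text \<open>The sign rule expresses \<open>\<partial> \<circ> \<partial> = 0\<close> below the members of the family; unlike orientations by a
  vertex order, it is visibly inherited by links.\<close>

definition sign_rule :: "('a set \<Rightarrow> 'a \<Rightarrow> real) \<Rightarrow> 'a set set \<Rightarrow> bool" where
  "sign_rule s \<F> \<longleftrightarrow> (\<forall>F\<in>\<F>. \<forall>S\<subseteq>F. (\<forall>v\<in>S. (s S v)\<^sup>2 = 1) \<and>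
     (\<forall>v\<in>S. \<forall>w\<in>S. v \<noteq> w \<longrightarrow> s S v * s (S - {v}) w = - (s S w * s (S - {w}) v)))"

text \<open>The incidence number of \<open>F\<close> and \<open>\<sigma>\<close>: at most one
  summand is nonzero.\<close>

definition bd :: "('a set \<Rightarrow> 'a \<Rightarrow> real) \<Rightarrow> 'a set \<Rightarrow> 'a set \<Rightarrow> real" where
  "bd s F \<sigma> = (\<Sum>v\<in>F. if \<sigma> = F - {v} then s F v else 0)"

section \<open>Links and truncated degrees\<close>

lemma inj_on_remove: "inj_on (\<lambda>F. F - {v}) {F\<in>\<F>. v \<in> F \<and> P F}"
  by (rule inj_on_inverseI[of _ "insert v"]) auto

lemma sum_lk: "(\<Sum>\<rho>\<in>lk v X. h \<rho>) = (\<Sum>\<sigma>\<in>{\<sigma>\<in>X. v \<in> \<sigma>}. h (\<sigma> - {v}))"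
  unfolding lk_def using inj_on_remove[of v X "\<lambda>_. True"] by (simp add: sum.reindex)

lemma deg_lk:
  assumes "v \<notin> \<rho>"
  shows "deg (lk v \<F>) \<rho> = deg \<F> (insert v \<rho>)"
proof -
  have "{G\<in>lk v \<F>. \<rho> \<subseteq> G} = (\<lambda>F. F - {v}) ` {F\<in>\<F>. v \<in> F \<and> \<rho> \<subseteq> F}"
    using assms by (auto simp: lk_def)
  thus ?thesis unfolding deg_def by (simp add: card_image[OF inj_on_remove])
qed

lemma card_lk: "card (lk v \<F>) = deg \<F> {v}"
  unfolding lk_def deg_def using card_image[OF inj_on_remove[of v \<F> "\<lambda>_. True"]] by simp

lemma uniform_family_lk:
  assumes "uniform_family (Suc r) \<F> X"
  shows "uniform_family r (lk v \<F>) (lk v X)"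
proof -
  have "F - {v} - {w} \<in> lk v X" if "F \<in> \<F>" "v \<in> F" "w \<in> F - {v}" for F w
  proof -
    have "F - {w} \<in> X" "v \<in> F - {w}" using assms that by (auto simp: uniform_family_def)
    moreover have "F - {v} - {w} = F - {w} - {v}" by auto
    ultimately show ?thesis by (auto simp: lk_def)
  qed
  thus ?thesis using assms by (auto simp: uniform_family_def lk_def)
qed

lemma sign_rule_lk:
  assumes "sign_rule s \<F>"
  shows "sign_rule (\<lambda>S. s (insert v S)) (lk v \<F>)"
  unfolding sign_rule_def
proof (intro ballI allI impI conjI)
  fix G S w assume GS: "G \<in> lk v \<F>" "S \<subseteq> G" and w: "w \<in> S"
  obtain F where F: "F \<in> \<F>" "v \<in> F" "G = F - {v}" using GS(1) by (auto simp: lk_def)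
  have S: "insert v S \<subseteq> F" "v \<notin> S" using F GS by auto
  have signs: "\<forall>x\<in>insert v S. (s (insert v S) x)\<^sup>2 = 1"
    and rule: "\<forall>x\<in>insert v S. \<forall>y\<in>insert v S. x \<noteq> y \<longrightarrow>
      s (insert v S) x * s (insert v S - {x}) y = - (s (insert v S) y * s (insert v S - {y}) x)"
    using assms F(1) S(1) unfolding sign_rule_def by blast+
  show "(s (insert v S) w)\<^sup>2 = 1" using signs w by blast
  fix x assume x: "x \<in> S" "w \<noteq> x"
  have sets: "insert v (S - {w}) = insert v S - {w}" "insert v (S - {x}) = insert v S - {x}"
    using S(2) w x by auto
  show "s (insert v S) w * s (insert v (S - {w})) x = - (s (insert v S) x * s (insert v (S - {x})) w)"
    unfolding sets using rule w x by blast
qed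

lemma sum_bd:
  assumes "finite X" "finite F" "\<And>v. v \<in> F \<Longrightarrow> F - {v} \<in> X"
  shows "(\<Sum>\<sigma>\<in>X. bd s F \<sigma> * h \<sigma>) = (\<Sum>v\<in>F. s F v * h (F - {v}))"
proof -
  have "(\<Sum>\<sigma>\<in>X. bd s F \<sigma> * h \<sigma>) = (\<Sum>v\<in>F. \<Sum>\<sigma>\<in>X. if \<sigma> = F - {v} then s F v * h \<sigma> else 0)"
    unfolding bd_def sum_distrib_right by (subst sum.swap) (intro sum.cong refl, auto)
  also have "\<dots> = (\<Sum>v\<in>F. s F v * h (F - {v}))"
    using assms by (intro sum.cong) auto
  finally show ?thesis .
qed

lemma sum_incidence:
  fixes h :: "'a set \<Rightarrow> 'b::{comm_semiring_1}"
  assumes "finite W" "finite X" "\<And>\<sigma>. \<sigma> \<in> X \<Longrightarrow> \<sigma> \<subseteq> W"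
  shows "(\<Sum>v\<in>W. \<Sum>\<sigma>\<in>{\<sigma>\<in>X. v \<in> \<sigma>}. h \<sigma>) = (\<Sum>\<sigma>\<in>X. of_nat (card \<sigma>) * h \<sigma>)"
proof -
  have "(\<Sum>v\<in>W. \<Sum>\<sigma>\<in>{\<sigma>\<in>X. v \<in> \<sigma>}. h \<sigma>) = (\<Sum>\<sigma>\<in>X. \<Sum>v\<in>{v\<in>W. v \<in> \<sigma>}. h \<sigma>)"
    by (rule sum.swap_restrict[OF assms(1,2)])
  also have "\<dots> = (\<Sum>\<sigma>\<in>X. of_nat (card \<sigma>) * h \<sigma>)"
  proof (rule sum.cong[OF refl])
    fix \<sigma> assume "\<sigma> \<in> X"
    hence "{v\<in>W. v \<in> \<sigma>} = \<sigma>" using assms(3) by blast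
    thus "(\<Sum>v\<in>{v\<in>W. v \<in> \<sigma>}. h \<sigma>) = of_nat (card \<sigma>) * h \<sigma>" by simp
  qed
  finally show ?thesis .
qed

text \<open>Choose \<open>min (card \<G>) t\<close> members and count their vertices: a vertex
  \<open>w\<close> lies in at most \<open>deg \<G> {w}\<close> of them, and in at most
  \<open>t\<close>.\<close>

lemma truncated_degree_le_link:
  assumes "finite \<G>" "finite W" "\<And>G. G \<in> \<G> \<Longrightarrow> G \<subseteq> W \<and> card G = k"
  shows "k * min (card \<G>) t \<le> (\<Sum>w\<in>W. min (deg \<G> {w}) t)"
proof -
  obtain H where H: "H \<subseteq> \<G>" "card H = min (card \<G>) t"
    by (meson min.cobounded1 obtain_subset_with_card_n)
  have finH: "finite H" using H(1) assms(1) finite_subset by blast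
  have "k * min (card \<G>) t = (\<Sum>G\<in>H. of_nat (card G) * 1)"
    using assms(3) H by (simp add: subset_iff)
  also have "\<dots> = (\<Sum>w\<in>W. \<Sum>G\<in>{G\<in>H. w \<in> G}. 1)"
    by (rule sum_incidence[symmetric, OF assms(2) finH]) (use assms(3) H(1) in blast)
  also have "\<dots> \<le> (\<Sum>w\<in>W. min (deg \<G> {w}) t)"
  proof (rule sum_mono)
    fix w assume "w \<in> W"
    have "card {G\<in>H. w \<in> G} \<le> deg \<G> {w}"
      unfolding deg_def using H(1) assms(1) by (intro card_mono) auto
    moreover have "card {G\<in>H. w \<in> G} \<le> card H" by (intro card_mono finH) auto
    ultimately show "(\<Sum>G\<in>{G\<in>H. w \<in> G}. 1) \<le> min (deg \<G> {w}) t" using H(2) by simp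
  qed
  finally show ?thesis .
qed

text \<open>This pays for the shifts by 1 in the stars. In the step the preceding count is applied
  to the link of each \<open>v\<close>, whose members have \<open>r + 2\<close> vertices; each
  \<open>\<sigma>\<close> also lies in \<open>r + 2\<close> of the sums, so the factors cancel. For
  graphs the ridges are the vertices themselves.\<close>

lemma truncated_vertex_degrees_le:
  assumes "uniform_family (Suc r) \<F> X" "finite W" "\<Union>\<F> \<subseteq> W" "\<Union>X \<subseteq> W"
  shows "(\<Sum>v\<in>W. min (deg \<F> {v}) t) \<le> (\<Sum>\<sigma>\<in>X. min (deg \<F> \<sigma>) t)"
  using assms
proof (induction r arbitrary: \<F> X)
  case 0
  have fin: "finite \<F>" "finite X" using 0 by (auto simp: uniform_family_def)
  have "deg \<F> {v} = 0" if "{v} \<notin> X" for v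
  proof -
    have "v \<notin> F" if "F \<in> \<F>" for F
    proof
      assume v: "v \<in> F"
      have "card F = 2" using 0 that by (simp add: uniform_family_def)
      then obtain w where "w \<noteq> v" "F = {v, w}" using v by (metis card_2_iff doubleton_eq_iff insertE singletonD)
      hence "w \<in> F" "F - {w} = {v}" by auto
      thus False using 0 that \<open>{v} \<notin> X\<close> by (force simp: uniform_family_def)
    qed
    hence "{F\<in>\<F>. {v} \<subseteq> F} = {}" by blast
    thus ?thesis by (simp only: deg_def card.empty)
  qed
  hence "(\<Sum>v\<in>W. min (deg \<F> {v}) t) = (\<Sum>v\<in>{v\<in>W. {v} \<in> X}. min (deg \<F> {v}) t)"
    using 0 by (intro sum.mono_neutral_right) auto
  also have "\<dots> = (\<Sum>\<sigma>\<in>(\<lambda>v. {v}) ` {v\<in>W. {v} \<in> X}. min (deg \<F> \<sigma>) t)"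
    by (subst sum.reindex) (auto simp: inj_on_def)
  also have "\<dots> \<le> (\<Sum>\<sigma>\<in>X. min (deg \<F> \<sigma>) t)" using fin by (intro sum_mono2) auto
  finally show ?case .
next
  case (Suc r)
  have fin: "finite \<F>" "finite X" using Suc.prems by (auto simp: uniform_family_def)
  have link: "(r + 2) * min (deg \<F> {v}) t \<le> (\<Sum>\<sigma>\<in>{\<sigma>\<in>X. v \<in> \<sigma>}. min (deg \<F> \<sigma>) t)" for v
  proof -
    have uf: "uniform_family (Suc r) (lk v \<F>) (lk v X)" by (rule uniform_family_lk[OF Suc.prems(1)])
    have sub: "\<Union>(lk v \<F>) \<subseteq> W" "\<Union>(lk v X) \<subseteq> W" using Suc.prems by (auto simp: lk_def)
    have "(r + 2) * min (card (lk v \<F>)) t \<le> (\<Sum>w\<in>W. min (deg (lk v \<F>) {w}) t)"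
      by (rule truncated_degree_le_link) (use uf sub Suc.prems in \<open>auto simp: uniform_family_def\<close>)
    also have "\<dots> \<le> (\<Sum>\<rho>\<in>lk v X. min (deg (lk v \<F>) \<rho>) t)"
      by (rule Suc.IH[OF uf Suc.prems(2) sub])
    also have "\<dots> = (\<Sum>\<sigma>\<in>{\<sigma>\<in>X. v \<in> \<sigma>}. min (deg \<F> \<sigma>) t)"
      unfolding sum_lk by (rule sum.cong) (auto simp: deg_lk insert_absorb)
    finally show ?thesis by (simp add: card_lk)
  qed
  have "(r + 2) * (\<Sum>v\<in>W. min (deg \<F> {v}) t) \<le> (\<Sum>v\<in>W. \<Sum>\<sigma>\<in>{\<sigma>\<in>X. v \<in> \<sigma>}. min (deg \<F> \<sigma>) t)"
    unfolding sum_distrib_left by (intro sum_mono link)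
  also have "\<dots> = (\<Sum>\<sigma>\<in>X. of_nat (card \<sigma>) * min (deg \<F> \<sigma>) t)"
    by (rule sum_incidence[OF Suc.prems(2) fin(2)]) (use Suc.prems in auto)
  also have "\<dots> = (r + 2) * (\<Sum>\<sigma>\<in>X. min (deg \<F> \<sigma>) t)"
    using Suc.prems(1) by (simp add: sum_distrib_left uniform_family_def)
  finally have "(r + 2) * (\<Sum>v\<in>W. min (deg \<F> {v}) t) \<le> (r + 2) * (\<Sum>\<sigma>\<in>X. min (deg \<F> \<sigma>) t)" .
  thus ?case by (rule mult_left_le_imp_le) simp
qed

text \<open>For an edge the sign rule involves the signs of its vertices over the empty set.
  Multiplying by these signs turns every boundary into a plain difference of vertex values, so the
  energy is that of a graph Laplacian on the singletons.\<close>

lemma graph_case: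
  assumes uf: "uniform_family (Suc 0) \<F> X" and sr: "sign_rule s \<F>" and u: "orthonormal X t u"
  shows "(\<Sum>a<t. \<Sum>F\<in>\<F>. (\<Sum>\<sigma>\<in>X. bd s F \<sigma> * u a \<sigma>)\<^sup>2)
    \<le> (\<Sum>\<sigma>\<in>X. min (real (deg \<F> \<sigma>)) (real t))"
proof -
  have fin: "finite \<F>" "finite X" using uf by (auto simp: uniform_family_def)
  have X1: "\<exists>y. \<sigma> = {y}" if "\<sigma> \<in> X" for \<sigma> using uf that by (auto simp: uniform_family_def card_Suc_eq)
  have F2: "\<exists>x y. x \<noteq> y \<and> F = {x, y}" if "F \<in> \<F>" for F
  proof -
    have "card F = 2" using uf that by (simp add: uniform_family_def)
    thus ?thesis by (metis card_2_iff)
  qed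
  \<comment> \<open>The sign rule speaks only of vertices inside some member; an isolated vertex
    gets the default sign 1, so that \<open>\<tau>\<close> squares to 1 on all of
    \<open>X\<close>.\<close>
  define \<tau> where "\<tau> = (\<lambda>\<sigma>. if \<exists>F\<in>\<F>. \<sigma> \<subseteq> F then s \<sigma> (the_elem \<sigma>) else 1)"
  have \<tau>2: "(\<tau> \<sigma>)\<^sup>2 = 1" if "\<sigma> \<in> X" for \<sigma>
    using X1[OF that] sr by (auto simp: \<tau>_def sign_rule_def)
  define w where "w = (\<lambda>a \<sigma>. \<tau> \<sigma> * u a \<sigma>)"
  have w: "orthonormal X t w"
  proof -
    have "ip X (w a) (w b) = ip X (u a) (u b)" for a b
      unfolding ip_def w_def
    proof (rule sum.cong[OF refl])
      fix \<sigma> assume "\<sigma> \<in> X"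
      have "\<tau> \<sigma> * u a \<sigma> * (\<tau> \<sigma> * u b \<sigma>) = (\<tau> \<sigma>)\<^sup>2 * (u a \<sigma> * u b \<sigma>)" by (simp add: power2_eq_square)
      thus "\<tau> \<sigma> * u a \<sigma> * (\<tau> \<sigma> * u b \<sigma>) = u a \<sigma> * u b \<sigma>" using \<tau>2[OF \<open>\<sigma> \<in> X\<close>] by simp
    qed
    thus ?thesis using u by (simp add: orthonormal_def)
  qed
  have edge: "(\<Sum>\<sigma>\<in>X. bd s F \<sigma> * u a \<sigma>)\<^sup>2 = (\<Sum>v\<in>F. (w a (F - {v}) - w a {v})\<^sup>2) / 2"
    if F: "F \<in> \<F>" for F a
  proof -
    obtain x y where xy: "x \<noteq> y" "F = {x, y}" using F2[OF F] by blast
    have d: "{x, y} - {x} = {y}" "{x, y} - {y} = {x}" using xy by auto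
    have X: "{x} \<in> X" "{y} \<in> X" using uf F xy d by (auto simp: uniform_family_def)
    have \<tau>: "\<tau> {x} = s {x} x" "\<tau> {y} = s {y} y" using F xy by (auto simp: \<tau>_def)
    have rule: "s F x * \<tau> {y} = - (s F y * \<tau> {x})"
      using sr F xy d unfolding \<tau> sign_rule_def by (metis insertI1 insertI2 order_refl)
    have sF: "(s F x)\<^sup>2 = 1" using sr F xy by (auto simp: sign_rule_def)
    have uw: "u a {x} = \<tau> {x} * w a {x}" "u a {y} = \<tau> {y} * w a {y}"
      using \<tau>2[OF X(1)] \<tau>2[OF X(2)] by (simp_all add: w_def power2_eq_square flip: mult.assoc)
    have "(\<Sum>\<sigma>\<in>X. bd s F \<sigma> * u a \<sigma>) = (\<Sum>v\<in>F. s F v * u a (F - {v}))"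
      by (rule sum_bd[OF fin(2)]) (use uf F in \<open>auto simp: uniform_family_def\<close>)
    also have "\<dots> = s F x * u a {y} + s F y * u a {x}" using xy d by simp
    also have "\<dots> = (s F x * \<tau> {y}) * w a {y} + (s F y * \<tau> {x}) * w a {x}" by (simp add: uw)
    also have "\<dots> = (s F x * \<tau> {y}) * (w a {y} - w a {x})" using rule by (simp add: algebra_simps)
    finally have "(\<Sum>\<sigma>\<in>X. bd s F \<sigma> * u a \<sigma>)\<^sup>2 = (s F x)\<^sup>2 * (\<tau> {y})\<^sup>2 * (w a {y} - w a {x})\<^sup>2"
      by (simp add: power_mult_distrib)
    also have "\<dots> = (w a {y} - w a {x})\<^sup>2" using sF \<tau>2[OF X(2)] by simp
    also have "\<dots> = (\<Sum>v\<in>F. (w a (F - {v}) - w a {v})\<^sup>2) / 2"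
      using xy d by (simp add: power2_commute[of "w a {x}"])
    finally show ?thesis .
  qed
  define A where "A = (\<lambda>\<sigma> \<rho>. if \<sigma> \<noteq> \<rho> \<and> \<sigma> \<union> \<rho> \<in> \<F> then 1 else (0::real))"
  have A_sym: "\<And>\<sigma> \<rho>. A \<sigma> \<rho> = A \<rho> \<sigma>" by (auto simp: A_def Un_commute)
  \<comment> \<open>An edge with a chosen end corresponds to an ordered pair of adjacent
    singletons.\<close>
  have pairs: "(\<Sum>F\<in>\<F>. \<Sum>v\<in>F. q (F - {v}) {v}) = (\<Sum>\<sigma>\<in>X. \<Sum>\<rho>\<in>X. A \<sigma> \<rho> * q \<sigma> \<rho>)"
    for q :: "'a set \<Rightarrow> 'a set \<Rightarrow> real"
  proof -
    let ?P = "{p\<in>X \<times> X. fst p \<noteq> snd p \<and> fst p \<union> snd p \<in> \<F>}"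
    have "(\<Sum>F\<in>\<F>. \<Sum>v\<in>F. q (F - {v}) {v}) = (\<Sum>(F, v)\<in>Sigma \<F> (\<lambda>F. F). q (F - {v}) {v})"
      by (rule sum.Sigma) (use fin uf in \<open>auto simp: uniform_family_def\<close>)
    also have "\<dots> = (\<Sum>p\<in>?P. q (fst p) (snd p))"
    proof (rule sum.reindex_bij_witness[of _ "\<lambda>p. (fst p \<union> snd p, the_elem (snd p))" "\<lambda>(F, v). (F - {v}, {v})"])
      fix p assume p: "p \<in> ?P"
      hence pX: "fst p \<in> X" "snd p \<in> X" by auto
      obtain x y where "fst p = {x}" "snd p = {y}" using X1[OF pX(1)] X1[OF pX(2)] by blast
      hence xy: "p = ({x}, {y})" "x \<noteq> y" using p by (auto simp: prod_eq_iff)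
      show "(case (fst p \<union> snd p, the_elem (snd p)) of (F, v) \<Rightarrow> (F - {v}, {v})) = p"
        "(fst p \<union> snd p, the_elem (snd p)) \<in> Sigma \<F> (\<lambda>F. F)"
        using p xy by auto
    next
      fix p assume p: "p \<in> Sigma \<F> (\<lambda>F. F)"
      then obtain F v where Fv: "p = (F, v)" "F \<in> \<F>" "v \<in> F" by auto
      obtain x y where "x \<noteq> y" "F = {x, y}" using F2[OF Fv(2)] by blast
      then obtain z where z: "F = {v, z}" "v \<noteq> z" using Fv(3) by auto
      hence "F - {v} = {z}" "F - {z} = {v}" by auto
      moreover have "F - {v} \<in> X" "F - {z} \<in> X" using uf Fv z by (auto simp: uniform_family_def)
      ultimately show "(case p of (F, v) \<Rightarrow> (F - {v}, {v})) \<in> ?P"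
        "(\<lambda>p. (fst p \<union> snd p, the_elem (snd p))) (case p of (F, v) \<Rightarrow> (F - {v}, {v})) = p"
        "q (fst (case p of (F, v) \<Rightarrow> (F - {v}, {v}))) (snd (case p of (F, v) \<Rightarrow> (F - {v}, {v}))) =
         (case p of (F, v) \<Rightarrow> q (F - {v}) {v})"
        using Fv z by auto
    qed
    also have "\<dots> = (\<Sum>p\<in>X \<times> X. A (fst p) (snd p) * q (fst p) (snd p))"
      by (rule sum.mono_neutral_cong_left) (use fin in \<open>auto simp: A_def\<close>)
    also have "\<dots> = (\<Sum>\<sigma>\<in>X. \<Sum>\<rho>\<in>X. A \<sigma> \<rho> * q \<sigma> \<rho>)"
      by (simp add: sum.cartesian_product case_prod_unfold)
    finally show ?thesis .
  qed
  have "(\<Sum>F\<in>\<F>. (\<Sum>\<sigma>\<in>X. bd s F \<sigma> * u a \<sigma>)\<^sup>2) = ip X (w a) (lap X A (w a))" for a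
  proof -
    have "(\<Sum>F\<in>\<F>. (\<Sum>\<sigma>\<in>X. bd s F \<sigma> * u a \<sigma>)\<^sup>2) = (\<Sum>F\<in>\<F>. \<Sum>v\<in>F. (w a (F - {v}) - w a {v})\<^sup>2) / 2"
      by (simp add: edge sum_divide_distrib)
    thus ?thesis by (simp add: pairs[of "\<lambda>\<sigma> \<rho>. (w a \<sigma> - w a \<rho>)\<^sup>2"] energy_eq[OF A_sym])
  qed
  hence "(\<Sum>a<t. \<Sum>F\<in>\<F>. (\<Sum>\<sigma>\<in>X. bd s F \<sigma> * u a \<sigma>)\<^sup>2) = (\<Sum>a<t. ip X (w a) (lap X A (w a)))" by simp
  also have "\<dots> \<le> (\<Sum>\<sigma>\<in>X. min (\<Sum>\<rho>\<in>X. A \<sigma> \<rho>) (real t))"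
    by (rule grone_merris[OF fin(2) A_sym _ _ _ w]) (auto simp: A_def)
  also have "\<dots> \<le> (\<Sum>\<sigma>\<in>X. min (real (deg \<F> \<sigma>)) (real t))"
  proof (intro sum_mono min.mono order_refl)
    fix \<sigma> assume \<sigma>: "\<sigma> \<in> X"
    have "(\<Sum>\<rho>\<in>X. A \<sigma> \<rho>) = real (card {\<rho>\<in>X. \<sigma> \<noteq> \<rho> \<and> \<sigma> \<union> \<rho> \<in> \<F>})"
      unfolding A_def using fin by (simp flip: sum.inter_filter)
    also have "card {\<rho>\<in>X. \<sigma> \<noteq> \<rho> \<and> \<sigma> \<union> \<rho> \<in> \<F>} \<le> deg \<F> \<sigma>"
      unfolding deg_def
    proof (rule card_inj_on_le[where f = "\<lambda>\<rho>. \<sigma> \<union> \<rho>"])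
      obtain y where y: "\<sigma> = {y}" using X1[OF \<sigma>] by blast
      show "inj_on (\<lambda>\<rho>. \<sigma> \<union> \<rho>) {\<rho>\<in>X. \<sigma> \<noteq> \<rho> \<and> \<sigma> \<union> \<rho> \<in> \<F>}"
      proof (rule inj_onI)
        fix \<rho> \<rho>' assume *: "\<rho> \<in> {\<rho>\<in>X. \<sigma> \<noteq> \<rho> \<and> \<sigma> \<union> \<rho> \<in> \<F>}" "\<rho>' \<in> {\<rho>\<in>X. \<sigma> \<noteq> \<rho> \<and> \<sigma> \<union> \<rho> \<in> \<F>}"
          "\<sigma> \<union> \<rho> = \<sigma> \<union> \<rho>'"
        have "\<rho> \<in> X" "\<rho>' \<in> X" using * by auto
        from X1[OF this(1)] X1[OF this(2)] obtain z z' where z: "\<rho> = {z}" "\<rho>' = {z'}" by blast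
        show "\<rho> = \<rho>'" using * unfolding y z by auto
      qed
    qed (use fin in auto)
    finally show "(\<Sum>\<rho>\<in>X. A \<sigma> \<rho>) \<le> real (deg \<F> \<sigma>)" by simp
  qed
  finally show ?thesis .
qed

section \<open>Stars and the induction step\<close>

lemma bd_link:
  assumes "v \<notin> \<rho>" "v \<notin> G" "finite G"
  shows "bd s (insert v G) (insert v \<rho>) = bd (\<lambda>S. s (insert v S)) G \<rho>"
proof -
  have "bd s (insert v G) (insert v \<rho>) =
      (\<Sum>x\<in>G. if insert v \<rho> = insert v G - {x} then s (insert v G) x else 0)"
    unfolding bd_def using assms by (subst sum.insert) auto
  also have "\<dots> = bd (\<lambda>S. s (insert v S)) G \<rho>"
    unfolding bd_def
  proof (rule sum.cong[OF refl])
    fix x assume "x \<in> G"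
    hence "insert v G - {x} = insert v (G - {x})" using assms(2) by auto
    hence "insert v \<rho> = insert v G - {x} \<longleftrightarrow> \<rho> = G - {x}" using assms(1,2) by (simp add: insert_ident)
    thus "(if insert v \<rho> = insert v G - {x} then s (insert v G) x else 0) =
        (if \<rho> = G - {x} then s (insert v G) x else 0)" by simp
  qed
  finally show ?thesis .
qed

text \<open>Up to signs, the Gram matrix of the boundaries of the faces around \<open>v\<close> is that of the link plus
  the identity: besides the faces through \<open>v\<close>, each member contains a single private face.\<close>

lemma star_bound:
  fixes z :: "nat \<Rightarrow> 'a set \<Rightarrow> real"
  assumes uf: "uniform_family (Suc r) \<F> X" and sr: "sign_rule s \<F>"
    and IH: "\<And>k u. k \<le> t \<Longrightarrow> orthonormal (lk v X) k u \<Longrightarrow>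
      (\<Sum>a<k. \<Sum>G\<in>lk v \<F>. (\<Sum>\<rho>\<in>lk v X. bd (\<lambda>S. s (insert v S)) G \<rho> * u a \<rho>)\<^sup>2) \<le> \<beta>"
    and z: "orthonormal {F\<in>\<F>. v \<in> F} t z"
  shows "(\<Sum>a<t. \<Sum>\<sigma>\<in>X. (\<Sum>F\<in>{F\<in>\<F>. v \<in> F}. bd s F \<sigma> * z a F)\<^sup>2) \<le> \<beta> + real t"
proof -
  let ?\<F> = "{F\<in>\<F>. v \<in> F}"
  have fin: "finite \<F>" "finite X" using uf by (auto simp: uniform_family_def)
  have finF: "finite F" if "F \<in> \<F>" for F using uf that by (auto simp: uniform_family_def)
  have lkfin: "finite (lk v \<F>)" "finite (lk v X)" using fin by (auto simp: lk_def)
  define z' where "z' = (\<lambda>a G. z a (insert v G))"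
  have z': "orthonormal (lk v \<F>) t z'"
  proof -
    have "ip (lk v \<F>) (z' a) (z' b) = ip ?\<F> (z a) (z b)" for a b
      unfolding ip_def sum_lk z'_def by (rule sum.cong) (auto simp: insert_absorb)
    thus ?thesis using z by (simp add: orthonormal_def)
  qed
  have through: "(\<Sum>a<t. \<Sum>\<sigma>\<in>{\<sigma>\<in>X. v \<in> \<sigma>}. (\<Sum>F\<in>?\<F>. bd s F \<sigma> * z a F)\<^sup>2) \<le> \<beta>"
  proof -
    have "(\<Sum>F\<in>?\<F>. bd s F \<sigma> * z a F) = (\<Sum>G\<in>lk v \<F>. bd (\<lambda>S. s (insert v S)) G (\<sigma> - {v}) * z' a G)"
      if "v \<in> \<sigma>" for \<sigma> a
      unfolding sum_lk z'_def
    proof (rule sum.cong[OF refl])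
      fix F assume F: "F \<in> ?\<F>"
      have "bd s F \<sigma> = bd s (insert v (F - {v})) (insert v (\<sigma> - {v}))"
        using F that by (simp add: insert_absorb)
      also have "\<dots> = bd (\<lambda>S. s (insert v S)) (F - {v}) (\<sigma> - {v})"
        by (rule bd_link) (use F finF in auto)
      finally show "bd s F \<sigma> * z a F =
          bd (\<lambda>S. s (insert v S)) (F - {v}) (\<sigma> - {v}) * z a (insert v (F - {v}))"
        using F by (simp add: insert_absorb)
    qed
    hence "(\<Sum>a<t. \<Sum>\<sigma>\<in>{\<sigma>\<in>X. v \<in> \<sigma>}. (\<Sum>F\<in>?\<F>. bd s F \<sigma> * z a F)\<^sup>2) =
        (\<Sum>a<t. \<Sum>\<rho>\<in>lk v X. (\<Sum>G\<in>lk v \<F>. bd (\<lambda>S. s (insert v S)) G \<rho> * z' a G)\<^sup>2)"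
      unfolding sum_lk[of _ v X] by (intro sum.cong) auto
    also have "\<dots> \<le> \<beta>"
      by (rule frame_sum_transpose[OF lkfin(2,1) _ z', where b = "\<lambda>\<rho> G. bd (\<lambda>S. s (insert v S)) G \<rho>"])
        (rule IH)
    finally show ?thesis .
  qed
  have own: "(\<Sum>\<sigma>\<in>{\<sigma>\<in>X. v \<notin> \<sigma>}. (\<Sum>F\<in>?\<F>. bd s F \<sigma> * z a F)\<^sup>2) = (\<Sum>F\<in>?\<F>. (z a F)\<^sup>2)" for a
  proof -
    have bd0: "bd s F \<sigma> = (if F = insert v \<sigma> then s F v else 0)" if "F \<in> ?\<F>" "v \<notin> \<sigma>" for F \<sigma>
    proof -
      have "bd s F \<sigma> = (\<Sum>x\<in>F. if x = v then (if F = insert v \<sigma> then s F v else 0) else 0)"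
        unfolding bd_def by (rule sum.cong) (use that in auto)
      thus ?thesis using that finF by simp
    qed
    have val: "(\<Sum>F\<in>?\<F>. bd s F \<sigma> * z a F) = (if insert v \<sigma> \<in> \<F> then s (insert v \<sigma>) v * z a (insert v \<sigma>) else 0)"
      if "v \<notin> \<sigma>" for \<sigma>
    proof -
      have "(\<Sum>F\<in>?\<F>. bd s F \<sigma> * z a F) = (\<Sum>F\<in>?\<F>. if F = insert v \<sigma> then s F v * z a F else 0)"
        by (rule sum.cong) (use bd0 that in auto)
      thus ?thesis using fin by simp
    qed
    have s1: "(s F v)\<^sup>2 = 1" if "F \<in> ?\<F>" for F using sr that by (auto simp: sign_rule_def)
    have "(\<Sum>\<sigma>\<in>{\<sigma>\<in>X. v \<notin> \<sigma>}. (\<Sum>F\<in>?\<F>. bd s F \<sigma> * z a F)\<^sup>2) =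
        (\<Sum>\<sigma>\<in>{\<sigma>\<in>X. v \<notin> \<sigma>}. if insert v \<sigma> \<in> \<F> then (z a (insert v \<sigma>))\<^sup>2 else 0)"
      by (rule sum.cong) (use val s1 in \<open>auto simp: power_mult_distrib\<close>)
    also have "\<dots> = (\<Sum>\<sigma>\<in>lk v \<F>. (z a (insert v \<sigma>))\<^sup>2)"
      by (rule sum.mono_neutral_cong_right)
        (use fin uf in \<open>auto simp: lk_def insert_absorb uniform_family_def image_iff\<close>)
    also have "\<dots> = (\<Sum>F\<in>?\<F>. (z a F)\<^sup>2)"
      unfolding sum_lk by (rule sum.cong) (auto simp: insert_absorb)
    finally show ?thesis .
  qed
  have "(\<Sum>a<t. \<Sum>\<sigma>\<in>X. (\<Sum>F\<in>?\<F>. bd s F \<sigma> * z a F)\<^sup>2) =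
      (\<Sum>a<t. \<Sum>\<sigma>\<in>{\<sigma>\<in>X. v \<in> \<sigma>}. (\<Sum>F\<in>?\<F>. bd s F \<sigma> * z a F)\<^sup>2) + (\<Sum>a<t. \<Sum>F\<in>?\<F>. (z a F)\<^sup>2)"
  proof -
    have "X = {\<sigma>\<in>X. v \<in> \<sigma>} \<union> {\<sigma>\<in>X. v \<notin> \<sigma>}" by auto
    hence "(\<Sum>\<sigma>\<in>X. h \<sigma>) = (\<Sum>\<sigma>\<in>{\<sigma>\<in>X. v \<in> \<sigma>}. h \<sigma>) + (\<Sum>\<sigma>\<in>{\<sigma>\<in>X. v \<notin> \<sigma>}. h \<sigma>)" for h :: "'a set \<Rightarrow> real"
      using sum.union_disjoint[of "{\<sigma>\<in>X. v \<in> \<sigma>}" "{\<sigma>\<in>X. v \<notin> \<sigma>}" h] fin by auto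
    thus ?thesis by (simp add: own sum.distrib)
  qed
  also have "(\<Sum>a<t. \<Sum>F\<in>?\<F>. (z a F)\<^sup>2) = real t"
    using orthonormal_trace[OF z] by (subst sum.swap)
  finally show ?thesis using through by linarith
qed

theorem boundary_frame_bound:
  assumes "uniform_family (Suc r) \<F> X" "sign_rule s \<F>" "orthonormal X t u"
  shows "(\<Sum>a<t. \<Sum>F\<in>\<F>. (\<Sum>\<sigma>\<in>X. bd s F \<sigma> * u a \<sigma>)\<^sup>2)
    \<le> (\<Sum>\<sigma>\<in>X. min (real (deg \<F> \<sigma>)) (real t))"
  using assms
proof (induction r arbitrary: \<F> X s t u)
  case 0
  thus ?case by (rule graph_case)
next
  case (Suc r)
  note uf = Suc.prems(1) and sr = Suc.prems(2) and u = Suc.prems(3)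
  have fin: "finite \<F>" "finite X" using uf by (auto simp: uniform_family_def)
  define W where "W = \<Union>\<F> \<union> \<Union>X"
  have finW: "finite W" using uf by (auto simp: W_def uniform_family_def)
  define Q where "Q = (\<lambda>F. \<Sum>a<t. (\<Sum>\<sigma>\<in>X. bd s F \<sigma> * u a \<sigma>)\<^sup>2)"
  define S where "S = (\<Sum>\<sigma>\<in>X. min (real (deg \<F> \<sigma>)) (real t))"
  have star: "(\<Sum>F\<in>{F\<in>\<F>. v \<in> F}. Q F) \<le>
      (\<Sum>\<sigma>\<in>{\<sigma>\<in>X. v \<in> \<sigma>}. min (real (deg \<F> \<sigma>)) (real t)) + min (real (deg \<F> {v})) (real t)" for v
  proof -
    let ?\<F> = "{F\<in>\<F>. v \<in> F}"
    have "(\<Sum>F\<in>?\<F>. Q F) = (\<Sum>a<t. \<Sum>F\<in>?\<F>. (\<Sum>\<sigma>\<in>X. bd s F \<sigma> * u a \<sigma>)\<^sup>2)"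
      unfolding Q_def by (rule sum.swap)
    also have "\<dots> \<le> (\<Sum>\<sigma>\<in>{\<sigma>\<in>X. v \<in> \<sigma>}. min (real (deg \<F> \<sigma>)) (real t)) + min (real (deg \<F> {v})) (real t)"
    \<comment> \<open>The frame moves from the ridges to the members of the star, where the Gram
      matrix is comparable with that of the link.\<close>
    proof (rule frame_sum_transpose[OF _ fin(2) _ u])
      show "finite ?\<F>" using fin by simp
      fix k z assume k: "k \<le> t" and z: "orthonormal ?\<F> k z"
      have "(\<Sum>a<k. \<Sum>\<sigma>\<in>X. (\<Sum>F\<in>?\<F>. bd s F \<sigma> * z a F)\<^sup>2) \<le>
          (\<Sum>\<rho>\<in>lk v X. min (real (deg (lk v \<F>) \<rho>)) (real k)) + real k"
      proof (rule star_bound[OF uf sr _ z])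
        fix l y assume l: "l \<le> k" and y: "orthonormal (lk v X) l y"
        have "(\<Sum>a<l. \<Sum>G\<in>lk v \<F>. (\<Sum>\<rho>\<in>lk v X. bd (\<lambda>S. s (insert v S)) G \<rho> * y a \<rho>)\<^sup>2)
            \<le> (\<Sum>\<rho>\<in>lk v X. min (real (deg (lk v \<F>) \<rho>)) (real l))"
          by (rule Suc.IH[OF uniform_family_lk[OF uf] sign_rule_lk[OF sr] y])
        also have "\<dots> \<le> (\<Sum>\<rho>\<in>lk v X. min (real (deg (lk v \<F>) \<rho>)) (real k))"
          using l by (intro sum_mono min.mono) auto
        finally show "(\<Sum>a<l. \<Sum>G\<in>lk v \<F>. (\<Sum>\<rho>\<in>lk v X. bd (\<lambda>S. s (insert v S)) G \<rho> * y a \<rho>)\<^sup>2)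
            \<le> (\<Sum>\<rho>\<in>lk v X. min (real (deg (lk v \<F>) \<rho>)) (real k))" .
      qed
      also have "(\<Sum>\<rho>\<in>lk v X. min (real (deg (lk v \<F>) \<rho>)) (real k)) =
          (\<Sum>\<sigma>\<in>{\<sigma>\<in>X. v \<in> \<sigma>}. min (real (deg \<F> \<sigma>)) (real k))"
        unfolding sum_lk by (rule sum.cong) (auto simp: deg_lk insert_absorb)
      also have "\<dots> \<le> (\<Sum>\<sigma>\<in>{\<sigma>\<in>X. v \<in> \<sigma>}. min (real (deg \<F> \<sigma>)) (real t))"
        using k by (intro sum_mono min.mono) auto
      \<comment> \<open>A frame on the star has no more vectors than the star has members; this
        sharpens the cost \<open>k\<close> of the shift to a truncated degree.\<close>
      also have "real k \<le> min (real (deg \<F> {v})) (real t)"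
        using orthonormal_card_le[OF _ z] fin k by (simp add: deg_def)
      finally show "(\<Sum>a<k. \<Sum>\<sigma>\<in>X. (\<Sum>F\<in>?\<F>. bd s F \<sigma> * z a F)\<^sup>2) \<le>
          (\<Sum>\<sigma>\<in>{\<sigma>\<in>X. v \<in> \<sigma>}. min (real (deg \<F> \<sigma>)) (real t)) + min (real (deg \<F> {v})) (real t)"
        by simp
    qed
    finally show ?thesis .
  qed
  \<comment> \<open>A member has \<open>r + 3\<close> vertices and a ridge has \<open>r + 2\<close>,
    so one copy of \<open>S\<close> is left over for the shifts.\<close>
  have "real (r + 3) * (\<Sum>F\<in>\<F>. Q F) = (\<Sum>F\<in>\<F>. of_nat (card F) * Q F)"
    using uf by (simp add: sum_distrib_left uniform_family_def add.commute)
  also have "\<dots> = (\<Sum>v\<in>W. \<Sum>F\<in>{F\<in>\<F>. v \<in> F}. Q F)"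
    by (rule sum_incidence[symmetric, OF finW fin(1)]) (auto simp: W_def)
  also have "\<dots> \<le> (\<Sum>v\<in>W. (\<Sum>\<sigma>\<in>{\<sigma>\<in>X. v \<in> \<sigma>}. min (real (deg \<F> \<sigma>)) (real t)) +
      min (real (deg \<F> {v})) (real t))"
    by (intro sum_mono star)
  also have "\<dots> = real (r + 2) * S + (\<Sum>v\<in>W. min (real (deg \<F> {v})) (real t))"
  proof -
    have "(\<Sum>v\<in>W. \<Sum>\<sigma>\<in>{\<sigma>\<in>X. v \<in> \<sigma>}. min (real (deg \<F> \<sigma>)) (real t)) =
        (\<Sum>\<sigma>\<in>X. of_nat (card \<sigma>) * min (real (deg \<F> \<sigma>)) (real t))"
      by (rule sum_incidence[OF finW fin(2)]) (auto simp: W_def)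
    also have "\<dots> = real (r + 2) * S"
      using uf by (simp add: S_def sum_distrib_left uniform_family_def)
    finally show ?thesis by (simp add: sum.distrib)
  qed
  also have "(\<Sum>v\<in>W. min (real (deg \<F> {v})) (real t)) \<le> S"
  proof -
    have "real (\<Sum>v\<in>W. min (deg \<F> {v}) t) \<le> real (\<Sum>\<sigma>\<in>X. min (deg \<F> \<sigma>) t)"
      by (rule of_nat_mono, rule truncated_vertex_degrees_le[OF uf finW]) (auto simp: W_def)
    thus ?thesis by (simp add: S_def of_nat_min)
  qed
  finally have "real (r + 3) * (\<Sum>F\<in>\<F>. Q F) \<le> real (r + 3) * S" by (simp add: algebra_simps)
  hence "(\<Sum>F\<in>\<F>. Q F) \<le> S" by simp
  moreover have "(\<Sum>F\<in>\<F>. Q F) = (\<Sum>a<t. \<Sum>F\<in>\<F>. (\<Sum>\<sigma>\<in>X. bd s F \<sigma> * u a \<sigma>)\<^sup>2)"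
    unfolding Q_def by (rule sum.swap)
  ultimately show ?case by (simp add: S_def)
qed

section \<open>The spectrum of the up-Laplacian\<close>

text \<open>The frame read along \<open>xs\<close> gives mutually inverse matrices \<open>P\<close>
  and \<open>Q\<close>, so the matrix is similar to a diagonal one. This carries the eigenvalues
  with their multiplicities into the characteristic polynomial.\<close>

lemma char_poly_frame:
  fixes M :: "'x \<Rightarrow> 'x \<Rightarrow> real"
  assumes fin: "finite X" and xs: "bij_betw ((!) xs) {..<n} X" "n = card X"
    and u: "orthonormal X n u"
    and eig: "\<And>a x. a < n \<Longrightarrow> x \<in> X \<Longrightarrow> mv X M (u a) x = \<nu> a * u a x"
  shows "char_poly (mat n n (\<lambda>(i, j). M (xs ! i) (xs ! j))) = (\<Prod>a\<leftarrow>map \<nu> [0..<n]. [:- a, 1:])"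
proof -
  define L P Q D where "L = mat n n (\<lambda>(i, j). M (xs ! i) (xs ! j))"
    and "P = mat n n (\<lambda>(i, a). u a (xs ! i))" and "Q = mat n n (\<lambda>(a, i). u a (xs ! i))"
    and "D = mat n n (\<lambda>(a, b). if a = b then \<nu> a else 0)"
  have xX: "xs ! i \<in> X" if "i < n" for i using xs(1) that by (auto simp: bij_betw_def)
  have x_eq: "xs ! i = xs ! j \<longleftrightarrow> i = j" if "i < n" "j < n" for i j
    using xs(1) that by (auto simp: bij_betw_def inj_on_def)
  note complete = orthonormal_complete[OF fin u[unfolded xs(2)], folded xs(2)]
  have PQ: "P * Q = 1\<^sub>m n"
  proof (rule eq_matI)
    fix i j assume "i < dim_row (1\<^sub>m n :: real mat)" "j < dim_col (1\<^sub>m n :: real mat)"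
    hence ij: "i < n" "j < n" by simp_all
    have "(P * Q) $$ (i, j) = (\<Sum>a<n. u a (xs ! i) * u a (xs ! j))"
      using ij by (simp add: P_def Q_def scalar_prod_def atLeast0LessThan)
    thus "(P * Q) $$ (i, j) = 1\<^sub>m n $$ (i, j)" using complete[OF xX xX] ij x_eq by simp
  qed (simp_all add: P_def Q_def)
  have QP: "Q * P = 1\<^sub>m n"
  proof (rule eq_matI)
    fix a b assume "a < dim_row (1\<^sub>m n :: real mat)" "b < dim_col (1\<^sub>m n :: real mat)"
    hence ab: "a < n" "b < n" by simp_all
    have "(Q * P) $$ (a, b) = (\<Sum>i<n. u a (xs ! i) * u b (xs ! i))"
      using ab by (simp add: P_def Q_def scalar_prod_def atLeast0LessThan)
    also have "\<dots> = ip X (u a) (u b)"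
      unfolding ip_def by (rule sum.reindex_bij_betw[OF xs(1)])
    finally show "(Q * P) $$ (a, b) = 1\<^sub>m n $$ (a, b)" using u ab by (simp add: orthonormal_def)
  qed (simp_all add: P_def Q_def)
  have PD: "P * D = mat n n (\<lambda>(i, a). \<nu> a * u a (xs ! i))"
  proof (rule eq_matI)
    fix i a assume "i < dim_row (mat n n (\<lambda>(i, a). \<nu> a * u a (xs ! i)))"
      "a < dim_col (mat n n (\<lambda>(i, a). \<nu> a * u a (xs ! i)))"
    hence ia: "i < n" "a < n" by simp_all
    have "(P * D) $$ (i, a) = (\<Sum>b<n. u b (xs ! i) * (if b = a then \<nu> b else 0))"
      using ia by (simp add: P_def D_def scalar_prod_def atLeast0LessThan)
    also have "\<dots> = \<nu> a * u a (xs ! i)" using ia by (simp add: if_distrib cong: if_cong)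
    finally show "(P * D) $$ (i, a) = mat n n (\<lambda>(i, a). \<nu> a * u a (xs ! i)) $$ (i, a)"
      using ia by simp
  qed (simp_all add: P_def D_def)
  have LPDQ: "L = P * D * Q"
  proof (rule eq_matI)
    fix i j assume "i < dim_row (P * D * Q)" "j < dim_col (P * D * Q)"
    hence ij: "i < n" "j < n" by (simp_all add: P_def Q_def)
    let ?x = "xs ! i" and ?y = "xs ! j"
    have "(P * D * Q) $$ (i, j) = (\<Sum>a<n. (\<nu> a * u a ?x) * u a ?y)"
      using ij unfolding PD by (simp add: Q_def scalar_prod_def atLeast0LessThan)
    also have "\<dots> = (\<Sum>a<n. mv X M (u a) ?x * u a ?y)"
      by (rule sum.cong) (use eig xX[OF ij(1)] in auto)
    also have "\<dots> = (\<Sum>z\<in>X. M ?x z * (\<Sum>a<n. u a z * u a ?y))"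
      unfolding mv_def sum_distrib_right sum_distrib_left
      by (subst sum.swap) (simp add: mult.assoc)
    also have "\<dots> = (\<Sum>z\<in>X. if z = ?y then M ?x z else 0)"
      by (rule sum.cong) (use complete[OF _ xX[OF ij(2)]] in auto)
    also have "\<dots> = M ?x ?y" using fin xX[OF ij(2)] by simp
    finally show "L $$ (i, j) = (P * D * Q) $$ (i, j)" using ij by (simp add: L_def)
  qed (simp_all add: L_def P_def Q_def)
  have "similar_mat L D"
    by (rule similar_matI[OF _ PQ QP LPDQ]) (auto simp: L_def P_def Q_def D_def)
  hence "char_poly L = char_poly D" by (rule char_poly_similar)
  also have "\<dots> = (\<Prod>a\<leftarrow>diag_mat D. [:- a, 1:])"
    by (rule char_poly_upper_triangular[of D n]) (auto simp: D_def upper_triangular_def)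
  also have "diag_mat D = map \<nu> [0..<n]" by (auto simp: diag_mat_def D_def)
  finally show ?thesis by (simp add: L_def)
qed

lemma proots_prod_linear: "proots (\<Prod>a\<leftarrow>xs. [:- a, 1:]) = mset (xs :: real list)"
proof (induction xs)
  case (Cons a xs)
  have "(\<Prod>a\<leftarrow>xs. [:- a, 1:]) \<noteq> 0" by (auto simp: prod_list_zero_iff)
  hence "proots ([:- a, 1:] * (\<Prod>a\<leftarrow>xs. [:- a, 1:])) = {#a#} + mset xs"
    by (subst proots_mult) (simp_all add: Cons.IH)
  thus ?case by (simp del: mult_pCons_left)
qed simp

lemma nonincreasing_list_mset:
  assumes "sorted (rev xs)"
  shows "nonincreasing_list (mset xs) = xs"
proof -
  have "sort xs = rev xs" by (rule properties_for_sort) (use assms in auto)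
  thus ?thesis by (simp add: nonincreasing_list_def)
qed

text \<open>For the \<open>j\<close>-th vertex in increasing order, counted from 0, this is the
  usual \<open>(-1)^j\<close>; counting smaller vertices shows directly how the removal of a vertex
  acts on signs.\<close>

definition vertex_sign :: "'a::linorder set \<Rightarrow> 'a \<Rightarrow> real" where
  "vertex_sign F v = (- 1) ^ card {x\<in>F. x < v}"

text \<open>Removing the larger vertex does not affect the sign of the smaller one, while removing
  the smaller vertex flips the sign of the larger one.\<close>

lemma vertex_sign_rule:
  assumes "finite S" "v \<in> S" "w \<in> S" "v \<noteq> w"
  shows "vertex_sign S v * vertex_sign (S - {v}) w = - (vertex_sign S w * vertex_sign (S - {w}) v)"
proof -
  have main: "vertex_sign S v * vertex_sign (S - {v}) w = - (vertex_sign S w * vertex_sign (S - {w}) v)"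
    if "v \<in> S" "w \<in> S" "v < w" for v w
  proof -
    have "{x\<in>S - {w}. x < v} = {x\<in>S. x < v}" using that by auto
    moreover have "{x\<in>S. x < w} = insert v {x\<in>S - {v}. x < w}" using that by auto
    ultimately show ?thesis using assms(1) by (simp add: vertex_sign_def)
  qed
  show ?thesis
  proof (cases "v < w")
    case True
    thus ?thesis using main assms by blast
  next
    case False
    hence "w < v" using assms by simp
    from main[OF assms(3,2) this] show ?thesis by simp
  qed
qed

lemma boundary_face_eq_bd:
  assumes "finite F"
  shows "boundary_face F G = bd vertex_sign F G"
proof -
  let ?l = "sorted_list_of_set F"
  have l: "sorted ?l" "distinct ?l" "set ?l = F" "length ?l = card F"
    using assms by (auto simp: sorted_list_of_set.length_sorted_key_list_of_set)
  have b: "bij_betw ((!) ?l) {..<card F} F"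
    using bij_betw_nth[OF l(2) _ l(3)[symmetric]] l(4) by simp
  have sl: "sorted_wrt (<) ?l" using l by (simp add: strict_sorted_iff)
  have sgn: "vertex_sign F (?l ! j) = (- 1) ^ j" if j: "j < card F" for j
  proof -
    have "{x\<in>F. x < ?l ! j} = (!) ?l ` {..<j}"
    proof (intro equalityI subsetI)
      fix x assume "x \<in> {x\<in>F. x < ?l ! j}"
      hence x: "x \<in> set ?l" "x < ?l ! j" using l(3) by auto
      then obtain i where i: "i < length ?l" "x = ?l ! i" by (auto simp: in_set_conv_nth)
      have "\<not> j \<le> i" using sorted_nth_mono[OF l(1), of j i] i x(2) by auto
      thus "x \<in> (!) ?l ` {..<j}" using i by auto
    next
      fix x assume "x \<in> (!) ?l ` {..<j}"
      then obtain i where i: "i < j" "x = ?l ! i" by auto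
      have "?l ! i < ?l ! j" using sorted_wrt_nth_less[OF sl i(1)] j l(4) by simp
      moreover have "?l ! i \<in> set ?l" using i j l(4) by (intro nth_mem) simp
      ultimately show "x \<in> {x\<in>F. x < ?l ! j}" using i l(3) by simp
    qed
    moreover have "inj_on ((!) ?l) {..<j}"
      using inj_on_subset[OF bij_betw_imp_inj_on[OF b], of "{..<j}"] j by auto
    ultimately show ?thesis by (simp add: vertex_sign_def card_image)
  qed
  have "boundary_face F G = (\<Sum>j<card F. if G = F - {?l ! j} then vertex_sign F (?l ! j) else 0)"
    unfolding boundary_face_def elementary_chain_def by (rule sum.cong) (auto simp: sgn)
  also have "\<dots> = bd vertex_sign F G"
    unfolding bd_def by (rule sum.reindex_bij_betw[OF b])
  finally show ?thesis .
qed

section \<open>Traces and conjugate degrees\<close>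

lemma bd_square:
  assumes F: "finite F" "card F = Suc (card \<sigma>)" "finite \<sigma>" and s: "\<And>v. v \<in> F \<Longrightarrow> (s F v)\<^sup>2 = 1"
  shows "(bd s F \<sigma>)\<^sup>2 = (if \<sigma> \<subseteq> F then 1 else 0)"
proof (cases "\<sigma> \<subseteq> F")
  case True
  have "card (F - \<sigma>) = 1" using True F by (simp add: card_Diff_subset)
  then obtain v where "F - \<sigma> = {v}" by (auto simp: card_1_singleton_iff)
  hence v: "v \<in> F" "\<sigma> = F - {v}" using True by auto
  have "bd s F \<sigma> = (\<Sum>x\<in>F. if x = v then s F x else 0)"
    unfolding bd_def by (rule sum.cong) (use v in auto)
  thus ?thesis using F v s by simp
next
  case False
  hence "bd s F \<sigma> = 0" unfolding bd_def by (intro sum.neutral) auto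
  thus ?thesis using False by simp
qed

text \<open>Both sides count the cells in the first \<open>l\<close> columns of the Young diagram
  with row lengths \<open>d \<sigma>\<close>, by columns and by rows.\<close>

lemma sum_conjugate:
  assumes "finite X"
  shows "(\<Sum>j=1..l. card {\<sigma>\<in>X. j \<le> d \<sigma>}) = (\<Sum>\<sigma>\<in>X. min (d \<sigma>) l)"
proof -
  have "(\<Sum>j=1..l. card {\<sigma>\<in>X. j \<le> d \<sigma>}) = (\<Sum>j=1..l. \<Sum>\<sigma>\<in>{\<sigma>\<in>X. j \<le> d \<sigma>}. 1)" by simp
  also have "\<dots> = (\<Sum>\<sigma>\<in>X. \<Sum>j\<in>{j\<in>{1..l}. j \<le> d \<sigma>}. 1)"
    by (rule sum.swap_restrict) (use assms in auto)
  also have "\<dots> = (\<Sum>\<sigma>\<in>X. min (d \<sigma>) l)"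
  proof (rule sum.cong[OF refl])
    fix \<sigma>
    have "{j\<in>{1..l}. j \<le> d \<sigma>} = {1..min (d \<sigma>) l}" by auto
    thus "(\<Sum>j\<in>{j\<in>{1..l}. j \<le> d \<sigma>}. 1) = min (d \<sigma>) l" by simp
  qed
  finally show ?thesis .
qed

text \<open>Sorting does not change how many degrees are at least \<open>j\<close>, and the index
  range is exactly the length of the list, so no padding zero is counted.\<close>

lemma conjugate_degree_sequence_eq:
  assumes fin: "finite (faces K i)" and j: "1 \<le> j"
  shows "conjugate_degree_sequence K i j = card {\<sigma>\<in>faces K i. j \<le> face_degree K \<sigma>}"
proof -
  define dl where "dl = degree_list K i"
  have m: "mset dl = image_mset (face_degree K) (mset_set (faces K i))"
    by (simp add: dl_def degree_list_def nonincreasing_list_def)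
  hence len: "length dl = card (faces K i)" by (metis size_image_mset size_mset size_mset_set)
  have "{t\<in>{1..card (faces K i)}. j \<le> zero_padded dl t} = Suc ` {t. t < length dl \<and> j \<le> dl ! t}"
    (is "?A = _")
  proof (intro equalityI subsetI)
    fix t assume "t \<in> ?A"
    thus "t \<in> Suc ` {t. t < length dl \<and> j \<le> dl ! t}"
      by (intro image_eqI[of _ _ "t - 1"]) (auto simp: zero_padded_def len)
  qed (auto simp: zero_padded_def len)
  hence "conjugate_degree_sequence K i j = card {t. t < length dl \<and> j \<le> dl ! t}"
    by (simp add: conjugate_degree_sequence_def degree_sequence_def dl_def card_image)
  also have "\<dots> = length (filter (\<lambda>x. j \<le> x) dl)" by (simp add: length_filter_conv_card)
  also have "\<dots> = size (filter_mset (\<lambda>x. j \<le> x) (mset dl))" by (simp flip: mset_filter)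
  also have "\<dots> = card {\<sigma>\<in>faces K i. j \<le> face_degree K \<sigma>}"
    using fin by (simp add: m filter_mset_image_mset)
  finally show ?thesis .
qed

theorem theorem1p3:
  fixes V :: "'a::linorder set" and K :: "'a set set" and r :: nat
  assumes "r \<ge> 1"
    and "simplicial_complex V K"
    and "complex_dim K = int r"
  shows "laplacian_spectrum K (int r - 1) \<preccurlyeq>
    (\<lambda>j. real (conjugate_degree_sequence K (int r - 1) j))"
proof -
  define X where "X = faces K (int r - 1)"
  define \<F> where "\<F> = faces K (int r)"
  have K: "finite V" "K \<subseteq> Pow V" "\<And>F G. F \<in> K \<Longrightarrow> G \<subseteq> F \<Longrightarrow> G \<in> K"
    using assms(2) by (auto simp: simplicial_complex_def)
  have "finite K" using K(1,2) by (simp add: finite_subset)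
  hence fin: "finite X" "finite \<F>" by (auto simp: X_def \<F>_def faces_def)
  have finK: "finite F" if "F \<in> K" for F using K that by (meson PowD finite_subset subsetD)
  have X: "\<sigma> \<in> X \<longleftrightarrow> \<sigma> \<in> K \<and> card \<sigma> = r" for \<sigma> by (auto simp: X_def faces_def)
  have F: "F \<in> \<F> \<longleftrightarrow> F \<in> K \<and> card F = Suc r" for F by (auto simp: \<F>_def faces_def)
  have uf: "uniform_family r \<F> X"
    unfolding uniform_family_def using fin finK K(3) by (auto simp: X F)
  have sr: "sign_rule vertex_sign \<F>"
    unfolding sign_rule_def
  proof (intro ballI allI impI conjI)
    fix F S :: "'a set" and v assume FS: "F \<in> \<F>" "S \<subseteq> F" and v: "v \<in> S"
    show "(vertex_sign S v)\<^sup>2 = 1" by (simp add: vertex_sign_def flip: power_mult)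
    fix w assume "w \<in> S" "v \<noteq> w"
    thus "vertex_sign S v * vertex_sign (S - {v}) w = - (vertex_sign S w * vertex_sign (S - {w}) v)"
      using FS v F finK finite_subset by (intro vertex_sign_rule) blast+
  qed
  \<comment> \<open>The Laplacian indexed by the faces themselves; the chosen enumerations enter
    only when it is compared with \<open>up_laplacian\<close>.\<close>
  define M where "M = (\<lambda>\<sigma> \<rho>. \<Sum>F\<in>\<F>. bd vertex_sign F \<sigma> * bd vertex_sign F \<rho>)"
  define n where "n = card X"
  obtain u \<nu> where u: "orthonormal X n u"
    and eig: "\<And>a x. a < n \<Longrightarrow> x \<in> X \<Longrightarrow> mv X M (u a) x = \<nu> a * u a x"
    and desc: "\<And>a b. a \<le> b \<Longrightarrow> b < n \<Longrightarrow> \<nu> b \<le> \<nu> a"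
    by (rule spectral_frame[OF fin(1), of M, folded n_def]) (auto simp: M_def mult.commute)
  have energy: "\<nu> a = (\<Sum>F\<in>\<F>. (\<Sum>\<sigma>\<in>X. bd vertex_sign F \<sigma> * u a \<sigma>)\<^sup>2)" if a: "a < n" for a
  proof -
    have "\<nu> a = ip X (u a) (\<lambda>x. \<nu> a * u a x)" using u a by (simp add: ip_linear orthonormal_def)
    also have "\<dots> = ip X (u a) (mv X M (u a))" by (rule ip_cong) (use eig[OF a] in auto)
    also have "\<dots> = (\<Sum>\<sigma>\<in>X. \<Sum>\<rho>\<in>X. \<Sum>F\<in>\<F>. (bd vertex_sign F \<sigma> * u a \<sigma>) * (bd vertex_sign F \<rho> * u a \<rho>))"
      unfolding ip_def mv_def M_def sum_distrib_left sum_distrib_right by (simp add: ac_simps)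
    also have "\<dots> = (\<Sum>\<sigma>\<in>X. \<Sum>F\<in>\<F>. \<Sum>\<rho>\<in>X. (bd vertex_sign F \<sigma> * u a \<sigma>) * (bd vertex_sign F \<rho> * u a \<rho>))"
      by (intro sum.cong refl sum.swap)
    also have "\<dots> = (\<Sum>F\<in>\<F>. \<Sum>\<sigma>\<in>X. \<Sum>\<rho>\<in>X. (bd vertex_sign F \<sigma> * u a \<sigma>) * (bd vertex_sign F \<rho> * u a \<rho>))"
      by (rule sum.swap)
    also have "\<dots> = (\<Sum>F\<in>\<F>. (\<Sum>\<sigma>\<in>X. bd vertex_sign F \<sigma> * u a \<sigma>)\<^sup>2)"
      by (simp add: power2_eq_square sum_product)
    finally show ?thesis .
  qed
  hence \<nu>0: "0 \<le> \<nu> a" if "a < n" for a using that by (simp add: sum_nonneg)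

  have list: "distinct (face_list K i) \<and> set (face_list K i) = faces K i" if "finite (faces K i)" for i
    unfolding face_list_def by (rule someI_ex) (use finite_distinct_list[OF that] in blast)
  define xs fs where "xs = face_list K (int r - 1)" and "fs = face_list K (int r)"
  have xs: "distinct xs" "set xs = X" and fs: "distinct fs" "set fs = \<F>"
    using list fin by (auto simp: xs_def fs_def X_def \<F>_def)
  have bxs: "bij_betw ((!) xs) {..<n} X"
    using bij_betw_nth[OF xs(1) _ xs(2)[symmetric]] distinct_card[OF xs(1)] xs(2) by (simp add: n_def)
  have bfs: "bij_betw ((!) fs) {..<card \<F>} \<F>"
    using bij_betw_nth[OF fs(1) _ fs(2)[symmetric]] distinct_card[OF fs(1)] fs(2) by simp
  have entry: "boundary_map K (int r) (elementary_chain F) G = bd vertex_sign F G" if "F \<in> \<F>" for F G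
  proof -
    have "boundary_map K (int r) (elementary_chain F) G = (\<Sum>F'\<in>\<F>. if F' = F then boundary_face F' G else 0)"
      unfolding boundary_map_def \<F>_def elementary_chain_def by (rule sum.cong) auto
    also have "\<dots> = boundary_face F G" using fin that by simp
    finally show ?thesis using boundary_face_eq_bd finK that F by metis
  qed
  have L: "up_laplacian K (int r - 1) = mat n n (\<lambda>(i, j). M (xs ! i) (xs ! j))"
  proof (rule eq_matI)
    fix i j assume "i < dim_row (mat n n (\<lambda>(i, j). M (xs ! i) (xs ! j)))"
      "j < dim_col (mat n n (\<lambda>(i, j). M (xs ! i) (xs ! j)))"
    hence ij: "i < n" "j < n" by simp_all
    have "up_laplacian K (int r - 1) $$ (i, j) = (\<Sum>b<card \<F>.
        boundary_map K (int r) (elementary_chain (fs ! b)) (xs ! i) *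
        boundary_map K (int r) (elementary_chain (fs ! b)) (xs ! j))"
      using ij unfolding up_laplacian_def boundary_matrix_def
      by (simp add: scalar_prod_def atLeast0LessThan n_def X_def \<F>_def xs_def fs_def)
    also have "\<dots> = (\<Sum>F\<in>\<F>. boundary_map K (int r) (elementary_chain F) (xs ! i) *
        boundary_map K (int r) (elementary_chain F) (xs ! j))"
      by (rule sum.reindex_bij_betw[OF bfs])
    also have "\<dots> = M (xs ! i) (xs ! j)" unfolding M_def by (rule sum.cong) (auto simp: entry)
    finally show "up_laplacian K (int r - 1) $$ (i, j) = mat n n (\<lambda>(i, j). M (xs ! i) (xs ! j)) $$ (i, j)"
      using ij by simp
  qed (simp_all add: up_laplacian_def boundary_matrix_def n_def X_def)
  have "char_poly (up_laplacian K (int r - 1)) = (\<Prod>a\<leftarrow>map \<nu> [0..<n]. [:- a, 1:])"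
    unfolding L by (rule char_poly_frame[OF fin(1) bxs n_def u eig])
  hence "proots (char_poly (up_laplacian K (int r - 1))) = mset (map \<nu> [0..<n])"
    by (simp only: proots_prod_linear)
  moreover have "sorted (rev (map \<nu> [0..<n]))"
    by (auto simp: sorted_iff_nth_mono rev_nth intro!: desc)
  ultimately have "eigenvalue_list (up_laplacian K (int r - 1)) = map \<nu> [0..<n]"
    by (simp only: eigenvalue_list_def nonincreasing_list_mset)
  hence spec: "laplacian_spectrum K (int r - 1) j = (if 1 \<le> j \<and> j \<le> n then \<nu> (j - 1) else 0)" for j
    by (auto simp: laplacian_spectrum_def zero_padded_def)

  have fdeg: "face_degree K = deg \<F>"
    by (simp add: fun_eq_iff face_degree_def deg_def assms(3) \<F>_def)
  have conj: "conjugate_degree_sequence K (int r - 1) j = card {\<sigma>\<in>X. j \<le> deg \<F> \<sigma>}" if "1 \<le> j" for j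
    using conjugate_degree_sequence_eq[OF fin(1)[unfolded X_def] that] by (simp add: fdeg X_def)
  have sum_conj: "(\<Sum>j=1..l. real (conjugate_degree_sequence K (int r - 1) j)) =
      (\<Sum>\<sigma>\<in>X. min (real (deg \<F> \<sigma>)) (real l))" for l
  proof -
    have "(\<Sum>j=1..l. conjugate_degree_sequence K (int r - 1) j) = (\<Sum>\<sigma>\<in>X. min (deg \<F> \<sigma>) l)"
      unfolding sum_conjugate[OF fin(1), symmetric] by (rule sum.cong) (auto simp: conj)
    hence "real (\<Sum>j=1..l. conjugate_degree_sequence K (int r - 1) j) = real (\<Sum>\<sigma>\<in>X. min (deg \<F> \<sigma>) l)"
      by simp
    thus ?thesis by (simp add: of_nat_min)
  qed
  have sum_spec: "(\<Sum>j=1..l. laplacian_spectrum K (int r - 1) j) = (\<Sum>a<min l n. \<nu> a)" for l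
  proof -
    have "(\<Sum>j=1..l. laplacian_spectrum K (int r - 1) j) = (\<Sum>a<l. laplacian_spectrum K (int r - 1) (Suc a))"
      by (simp add: sum.atLeast1_atMost_eq)
    also have "\<dots> = (\<Sum>a<l. if a < n then \<nu> a else 0)" by (rule sum.cong) (auto simp: spec)
    also have "\<dots> = (\<Sum>a<min l n. \<nu> a)" by (rule sum.mono_neutral_cong_right) auto
    finally show ?thesis .
  qed
  have bound: "(\<Sum>a<t. \<nu> a) \<le> (\<Sum>\<sigma>\<in>X. min (real (deg \<F> \<sigma>)) (real t))" if "t \<le> n" for t
  proof -
    \<comment> \<open>Here \<open>r \<ge> 1\<close> enters: the frame bound starts with
      graphs.\<close>
    obtain q where q: "r = Suc q" using assms(1) by (cases r) auto
    have "(\<Sum>a<t. \<nu> a) = (\<Sum>a<t. \<Sum>F\<in>\<F>. (\<Sum>\<sigma>\<in>X. bd vertex_sign F \<sigma> * u a \<sigma>)\<^sup>2)"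
      using energy that by (intro sum.cong) auto
    also have "\<dots> \<le> (\<Sum>\<sigma>\<in>X. min (real (deg \<F> \<sigma>)) (real t))"
      by (rule boundary_frame_bound[OF uf[unfolded q] sr orthonormal_mono[OF u that]])
    finally show ?thesis .
  qed
  have trace: "(\<Sum>a<n. \<nu> a) = (\<Sum>\<sigma>\<in>X. real (deg \<F> \<sigma>))"
  proof -
    \<comment> \<open>Parseval turns the trace into the sum of the squared entries of the boundary
      matrix; an entry is 1 or -1 at an incidence and 0 elsewhere.\<close>
    have par: "(\<Sum>a<n. (\<Sum>\<sigma>\<in>X. bd vertex_sign F \<sigma> * u a \<sigma>)\<^sup>2) = (\<Sum>\<sigma>\<in>X. (bd vertex_sign F \<sigma>)\<^sup>2)" for F
    proof -
      have "ip X (bd vertex_sign F) (bd vertex_sign F) =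
          (\<Sum>a<n. ip X (u a) (bd vertex_sign F) * ip X (u a) (bd vertex_sign F))"
        unfolding n_def by (rule parseval[OF fin(1) u[unfolded n_def]])
      thus ?thesis by (simp add: ip_def power2_eq_square mult.commute)
    qed
    have "(\<Sum>a<n. \<nu> a) = (\<Sum>a<n. \<Sum>F\<in>\<F>. (\<Sum>\<sigma>\<in>X. bd vertex_sign F \<sigma> * u a \<sigma>)\<^sup>2)"
      using energy by (intro sum.cong) auto
    also have "\<dots> = (\<Sum>F\<in>\<F>. \<Sum>\<sigma>\<in>X. (bd vertex_sign F \<sigma>)\<^sup>2)"
      by (subst sum.swap) (simp only: par)
    also have "\<dots> = (\<Sum>F\<in>\<F>. \<Sum>\<sigma>\<in>X. if \<sigma> \<subseteq> F then 1 else 0)"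
    proof (intro sum.cong refl)
      fix F \<sigma> assume *: "F \<in> \<F>" "\<sigma> \<in> X"
      show "(bd vertex_sign F \<sigma>)\<^sup>2 = (if \<sigma> \<subseteq> F then 1 else 0)"
        by (rule bd_square) (use * X F finK in \<open>auto simp: vertex_sign_def simp flip: power_mult\<close>)
    qed
    also have "\<dots> = (\<Sum>\<sigma>\<in>X. \<Sum>F\<in>\<F>. if \<sigma> \<subseteq> F then 1 else 0)" by (rule sum.swap)
    also have "\<dots> = (\<Sum>\<sigma>\<in>X. real (deg \<F> \<sigma>))"
      using fin by (simp add: deg_def flip: sum.inter_filter)
    finally show ?thesis .
  qed

  \<comment> \<open>Beyond \<open>N\<close> both sequences vanish: there are \<open>n\<close>
    eigenvalues, and no degree exceeds \<open>card \<F>\<close>. Both infinite sums thus end at the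
    same index.\<close>
  define N where "N = n + card \<F>"
  have deg_le: "deg \<F> \<sigma> \<le> card \<F>" for \<sigma> unfolding deg_def using fin by (intro card_mono) auto
  have zero1: "laplacian_spectrum K (int r - 1) (Suc i) = 0" if "i \<notin> {..<N}" for i
    using that by (simp add: spec N_def)
  have zero2: "real (conjugate_degree_sequence K (int r - 1) (Suc i)) = 0" if "i \<notin> {..<N}" for i
  proof -
    have "\<not> Suc i \<le> deg \<F> \<sigma>" for \<sigma> using deg_le[of \<sigma>] that by (simp add: N_def)
    hence "{\<sigma>\<in>X. Suc i \<le> deg \<F> \<sigma>} = {}" by blast
    hence "card {\<sigma>\<in>X. Suc i \<le> deg \<F> \<sigma>} = 0" by (simp only: card.empty)
    thus ?thesis using conj[of "Suc i"] by simp
  qed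
  show ?thesis
    unfolding majorized_by_def
  proof (intro conjI allI impI)
    show "nonincreasing_finsupp (laplacian_spectrum K (int r - 1))"
      unfolding nonincreasing_finsupp_def
    proof (intro conjI allI impI)
      fix i j :: nat assume ij: "1 \<le> i \<and> i \<le> j"
      show "laplacian_spectrum K (int r - 1) j \<le> laplacian_spectrum K (int r - 1) i"
        unfolding spec using ij \<nu>0[of "i - 1"] desc[of "i - 1" "j - 1"] by auto
    next
      show "finite {i. 1 \<le> i \<and> laplacian_spectrum K (int r - 1) i \<noteq> 0}"
        by (rule finite_subset[of _ "{..n}"]) (auto simp: spec split: if_splits)
    qed
    show "nonincreasing_finsupp (\<lambda>j. real (conjugate_degree_sequence K (int r - 1) j))"
      unfolding nonincreasing_finsupp_def
    proof (intro conjI allI impI)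
      fix i j :: nat assume ij: "1 \<le> i \<and> i \<le> j"
      have "card {\<sigma>\<in>X. j \<le> deg \<F> \<sigma>} \<le> card {\<sigma>\<in>X. i \<le> deg \<F> \<sigma>}"
        using fin ij by (intro card_mono) auto
      thus "real (conjugate_degree_sequence K (int r - 1) j) \<le> real (conjugate_degree_sequence K (int r - 1) i)"
        using ij by (simp add: conj)
    next
      show "finite {i. 1 \<le> i \<and> real (conjugate_degree_sequence K (int r - 1) i) \<noteq> 0}"
      proof (rule finite_subset[of _ "{..N}"])
        show "{i. 1 \<le> i \<and> real (conjugate_degree_sequence K (int r - 1) i) \<noteq> 0} \<subseteq> {..N}"
        proof
          fix i assume i: "i \<in> {i. 1 \<le> i \<and> real (conjugate_degree_sequence K (int r - 1) i) \<noteq> 0}"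
          hence "i - 1 \<in> {..<N}" using zero2[of "i - 1"] by auto
          thus "i \<in> {..N}" by auto
        qed
      qed simp
    qed
    fix l :: nat
    \<comment> \<open>A frame has at most \<open>n\<close> vectors, so for \<open>l > n\<close> the
      bound is used at \<open>n\<close>; the right side can only grow with \<open>l\<close>.\<close>
    have "(\<Sum>a<min l n. \<nu> a) \<le> (\<Sum>\<sigma>\<in>X. min (real (deg \<F> \<sigma>)) (real (min l n)))"
      by (rule bound) simp
    also have "\<dots> \<le> (\<Sum>\<sigma>\<in>X. min (real (deg \<F> \<sigma>)) (real l))"
      by (intro sum_mono min.mono) auto
    finally show "(\<Sum>i=1..l. laplacian_spectrum K (int r - 1) i) \<le>
        (\<Sum>i=1..l. real (conjugate_degree_sequence K (int r - 1) i))"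
      by (simp only: sum_spec sum_conj)
  next
    have "(\<Sum>i. laplacian_spectrum K (int r - 1) (Suc i)) = (\<Sum>i<N. laplacian_spectrum K (int r - 1) (Suc i))"
      by (rule suminf_finite) (use zero1 in auto)
    also have "\<dots> = (\<Sum>j=1..N. laplacian_spectrum K (int r - 1) j)"
      by (simp add: sum.atLeast1_atMost_eq)
    also have "\<dots> = (\<Sum>\<sigma>\<in>X. real (deg \<F> \<sigma>))" unfolding sum_spec by (simp add: N_def trace)
    also have "\<dots> = (\<Sum>\<sigma>\<in>X. min (real (deg \<F> \<sigma>)) (real N))"
    proof (rule sum.cong[OF refl])
      fix \<sigma>
      have "deg \<F> \<sigma> \<le> N" using deg_le[of \<sigma>] by (simp add: N_def)
      thus "real (deg \<F> \<sigma>) = min (real (deg \<F> \<sigma>)) (real N)" by simp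
    qed
    also have "\<dots> = (\<Sum>i<N. real (conjugate_degree_sequence K (int r - 1) (Suc i)))"
      unfolding sum_conj[symmetric] by (simp add: sum.atLeast1_atMost_eq)
    also have "\<dots> = (\<Sum>i. real (conjugate_degree_sequence K (int r - 1) (Suc i)))"
      by (rule suminf_finite[symmetric]) (use zero2 in auto)
    finally show "(\<Sum>i. laplacian_spectrum K (int r - 1) (Suc i)) =
        (\<Sum>i. real (conjugate_degree_sequence K (int r - 1) (Suc i)))" .
  qed
qed

end
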